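(* Let $p$ be an odd prime, $n\ge 1$, and let $D_{p^n}=\langle r,s\mid r^{p^n}=s^2=e,\ srs^{-1}=r^{-1}\rangle$ be the dihedral group of order $2p^n$. Then \[ c(D_{p^n})=\left\lfloor\frac{3n}{2}\right\rfloor+1=\begin{cases}3k+1 & n=2k,\\ 3k+2 & n=2k+1.\end{cases}\]
   Context: For a finite group $G$, a $G$-transfer system is a partial order $\to$ on the set $\operatorname{Sub}(G)$ of subgroups of $G$ such that: (i) $K\to H$ implies $K\le H$; (ii) $H\to H$ for all $H$; (iii) $L\to K$ and $K\to H$ imply $L\to H$; (iv) $K\to H$ and $L\le H$ imply $K\cap L\to H\cap L$; (v) $K\to H$ implies $gKg^{-1}\to gHg^{-1}$ for all $g\in G$. Let $\operatorname{Tr}(G)$ be the set of $G$-transfer systems. For a set $S$ of pairs $(K,H)$ with $K\le H$ (arrows), $\langle S\rangle$ denotes the smallest transfer system containing $S$. A minimal generating set of $T\in\operatorname{Tr}(G)$ is a set $S$ with $\langle S\rangle=T$ such that no $a\in S$ lies in $\langle S\setminus\{a\}\rangle$. All minimal generating sets of a given $T$ have the same size $m(T)$, and the complexity is $c(G)=\max\{m(T)\mid T\in\operatorname{Tr}(G)\}$. *)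

theory Defs
  imports "HOL-Algebra.Algebra"
begin

section \<open>Transfer systems\<close>

definition Sub :: "('a, 'b) monoid_scheme \<Rightarrow> 'a set set" where
  "Sub G = {H. subgroup H G}"

definition conj_set :: "('a, 'b) monoid_scheme \<Rightarrow> 'a \<Rightarrow> 'a set \<Rightarrow> 'a set" where
  "conj_set G g H = g <#\<^bsub>G\<^esub> (H #>\<^bsub>G\<^esub> inv\<^bsub>G\<^esub> g)"

text \<open>A relation is a set of pairs; \<open>(K, H) \<in> T\<close> stands for \<open>K \<rightarrow> H\<close>.\<close>

definition arrows :: "('a, 'b) monoid_scheme \<Rightarrow> ('a set \<times> 'a set) set" where
  "arrows G = {(K, H). K \<in> Sub G \<and> H \<in> Sub G \<and> K \<subseteq> H}"

definition transfer_system ::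
  "('a, 'b) monoid_scheme \<Rightarrow> ('a set \<times> 'a set) set \<Rightarrow> bool" where
  "transfer_system G T \<longleftrightarrow>
     partial_order_on (Sub G) T \<and>
     (\<forall>K H. (K, H) \<in> T \<longrightarrow> K \<subseteq> H) \<and>
     (\<forall>K H. \<forall>L \<in> Sub G. (K, H) \<in> T \<and> L \<subseteq> H \<longrightarrow> (K \<inter> L, H \<inter> L) \<in> T) \<and>
     (\<forall>K H. \<forall>g \<in> carrier G. (K, H) \<in> T \<longrightarrow> (conj_set G g K, conj_set G g H) \<in> T)"

definition Tr :: "('a, 'b) monoid_scheme \<Rightarrow> ('a set \<times> 'a set) set set" where
  "Tr G = {T. transfer_system G T}"

text \<open>
  For \<open>S \<subseteq> arrows G\<close> the intersection of all transfer systems containing \<open>S\<close> is itself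
  a transfer system (lemma \<open>transfer_system_ts_gen\<close> below), hence the smallest one containing \<open>S\<close>.
\<close>

definition ts_gen ::
  "('a, 'b) monoid_scheme \<Rightarrow> ('a set \<times> 'a set) set \<Rightarrow> ('a set \<times> 'a set) set" where
  "ts_gen G S = transfer_system G hull S"

definition minimal_generating_set ::
  "('a, 'b) monoid_scheme \<Rightarrow> ('a set \<times> 'a set) set \<Rightarrow> ('a set \<times> 'a set) set \<Rightarrow> bool" where
  "minimal_generating_set G T S \<longleftrightarrow>
     S \<subseteq> arrows G \<and> ts_gen G S = T \<and> (\<forall>a \<in> S. a \<notin> ts_gen G (S - {a}))"

text \<open>
  For finite \<open>G\<close>, every transfer system has a minimal generating set, and all of them have the
  same cardinality, so the choice made by \<open>SOME\<close> is immaterial.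
\<close>

definition min_gen_size ::
  "('a, 'b) monoid_scheme \<Rightarrow> ('a set \<times> 'a set) set \<Rightarrow> nat" where
  "min_gen_size G T = card (SOME S. minimal_generating_set G T S)"

definition complexity :: "('a, 'b) monoid_scheme \<Rightarrow> nat" where
  "complexity G = Max {min_gen_size G T | T. T \<in> Tr G}"


section \<open>Dihedral groups\<close>

text \<open>
  A group generated by \<open>r\<close>, \<open>s\<close> satisfying these relations is a quotient of the group presented
  by \<open>\<langle>r, s | r\<^sup>N = s\<^sup>2 = e, s r s\<^sup>-\<^sup>1 = r\<^sup>-\<^sup>1\<rangle>\<close>; as the latter has order \<open>2 N\<close>, the condition on
  the order says that the quotient map is an isomorphism.
\<close>

definition dihedral ::
  "('a, 'b) monoid_scheme \<Rightarrow> nat \<Rightarrow> 'a \<Rightarrow> 'a \<Rightarrow> bool" where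
  "dihedral G N r s \<longleftrightarrow>
     group G \<and> r \<in> carrier G \<and> s \<in> carrier G \<and>
     carrier G = generate G {r, s} \<and>
     r [^]\<^bsub>G\<^esub> N = \<one>\<^bsub>G\<^esub> \<and> s [^]\<^bsub>G\<^esub> (2::nat) = \<one>\<^bsub>G\<^esub> \<and>
     s \<otimes>\<^bsub>G\<^esub> r \<otimes>\<^bsub>G\<^esub> inv\<^bsub>G\<^esub> s = inv\<^bsub>G\<^esub> r \<and>
     order G = 2 * N"


section \<open>Sanity checks\<close>

lemma (in group) conj_set_mem:
  assumes "g \<in> carrier G" "H \<subseteq> carrier G"
  shows "conj_set G g H = (\<lambda>h. g \<otimes> h \<otimes> inv g) ` H"
  using assms by (auto simp: conj_set_def l_coset_def r_coset_def m_assoc subset_iff image_iff)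

lemma (in group) conj_set_subgroup:
  assumes g: "g \<in> carrier G" and H: "subgroup H G"
  shows "subgroup (conj_set G g H) G"
proof -
  have sub: "H \<subseteq> carrier G" using H by (rule subgroup.subset)
  let ?f = "\<lambda>h. g \<otimes> h \<otimes> inv g"
  have cancel: "inv g \<otimes> (g \<otimes> x) = x" if "x \<in> carrier G" for x
    using g that by (simp add: m_assoc[symmetric])
  have "?f \<in> hom G G"
    using g by (intro homI) (simp_all add: m_assoc cancel)
  then interpret group_hom G G ?f
    by unfold_locales
  show ?thesis
    using subgroup_img_is_subgroup[OF H] by (simp add: conj_set_mem[OF g sub])
qed

lemma (in group) transfer_system_arrows: "transfer_system G (arrows G)"
  unfolding transfer_system_def
proof (intro conjI allI ballI impI)
  show "partial_order_on (Sub G) (arrows G)"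
    by (auto simp: order_on_defs refl_on_def trans_def antisym_def arrows_def)
next
  fix K H L assume "L \<in> Sub G" "(K, H) \<in> arrows G \<and> L \<subseteq> H"
  then show "(K \<inter> L, H \<inter> L) \<in> arrows G"
    by (auto simp: arrows_def Sub_def intro: subgroups_Inter_pair)
next
  fix K H g assume g: "g \<in> carrier G" and KH: "(K, H) \<in> arrows G"
  then show "(conj_set G g K, conj_set G g H) \<in> arrows G"
    by (auto simp: arrows_def Sub_def intro: conj_set_subgroup)
       (auto simp: conj_set_def l_coset_def r_coset_def)
qed (auto simp: arrows_def)

lemma transfer_system_subset_arrows: "transfer_system G T \<Longrightarrow> T \<subseteq> arrows G"
  by (auto simp: transfer_system_def arrows_def order_on_defs)

lemma transfer_system_Inter:
  assumes "\<T> \<noteq> {}" "\<And>T. T \<in> \<T> \<Longrightarrow> transfer_system G T"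
  shows "transfer_system G (\<Inter>\<T>)"
proof -
  obtain T where T: "T \<in> \<T>" using assms(1) by blast
  have sub: "\<Inter>\<T> \<subseteq> T" using T by blast
  have po: "partial_order_on (Sub G) U" if "U \<in> \<T>" for U
    using assms(2)[OF that] by (simp add: transfer_system_def)
  have "\<Inter>\<T> \<subseteq> Sub G \<times> Sub G"
    using po[OF T] sub unfolding order_on_defs by blast
  moreover have "refl_on (Sub G) (\<Inter>\<T>)"
    using po unfolding order_on_defs refl_on_def by blast
  moreover have "trans (\<Inter>\<T>)"
    using po unfolding order_on_defs by (intro trans_INTER[of \<T> "\<lambda>x. x", simplified]) blast
  moreover have "antisym (\<Inter>\<T>)"
    using po[OF T] sub unfolding order_on_defs by (blast intro: antisym_subset)
  ultimately have "partial_order_on (Sub G) (\<Inter>\<T>)"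
    by (simp add: order_on_defs)
  moreover have "\<forall>K H. (K, H) \<in> \<Inter>\<T> \<longrightarrow> K \<subseteq> H"
    using assms(2)[OF T] sub unfolding transfer_system_def by blast
  ultimately show ?thesis
    using assms(2) unfolding transfer_system_def by blast
qed

lemma transfer_system_ts_gen:
  assumes "group G" "S \<subseteq> arrows G"
  shows "transfer_system G (ts_gen G S)"
  unfolding ts_gen_def hull_def
  using assms group.transfer_system_arrows[of G] by (intro transfer_system_Inter) auto

definition dihedral_model :: "nat \<Rightarrow> (int \<times> bool) monoid" where
  "dihedral_model N =
     \<lparr>carrier = {0..<int N} \<times> UNIV,
      monoid.mult = (\<lambda>(a, b) (c, d). ((if b then a - c else a + c) mod int N, b \<noteq> d)),
      monoid.one = (0, False)\<rparr>"

lemma dihedral_dihedral_model: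
  assumes "N \<ge> 1"
  shows "dihedral (dihedral_model N) N (1 mod int N, False) (0, True)"
proof -
  let ?G = "dihedral_model N" and ?r = "(1 mod int N, False)" and ?s = "(0::int, True)"
  note defs = dihedral_model_def
  have N: "int N > 0" using assms by simp
  interpret group ?G
  proof (rule groupI)
    fix x assume x: "x \<in> carrier ?G"
    obtain a b where ab: "x = (a, b)" by (cases x)
    have "((if b then a else - a) mod int N, b) \<otimes>\<^bsub>?G\<^esub> x = \<one>\<^bsub>?G\<^esub>"
      by (auto simp: ab defs mod_simps)
    moreover have "((if b then a else - a) mod int N, b) \<in> carrier ?G"
      using N by (simp add: defs)
    ultimately show "\<exists>y\<in>carrier ?G. y \<otimes>\<^bsub>?G\<^esub> x = \<one>\<^bsub>?G\<^esub>" by blast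
  next
    fix x y z assume "x \<in> carrier ?G" "y \<in> carrier ?G" "z \<in> carrier ?G"
    then show "x \<otimes>\<^bsub>?G\<^esub> y \<otimes>\<^bsub>?G\<^esub> z = x \<otimes>\<^bsub>?G\<^esub> (y \<otimes>\<^bsub>?G\<^esub> z)"
      by (auto simp: defs mod_simps algebra_simps)
  qed (use N in \<open>auto simp: defs\<close>)
  have r: "?r \<in> carrier ?G" and s: "?s \<in> carrier ?G" using N by (auto simp: defs)
  have pow: "?r [^]\<^bsub>?G\<^esub> k = (int k mod int N, False)" for k :: nat
  proof (induction k)
    case (Suc k) then show ?case by (simp add: defs mod_simps add.commute)
  qed (simp add: defs)
  have ss: "?s \<otimes>\<^bsub>?G\<^esub> ?s = \<one>\<^bsub>?G\<^esub>" by (simp add: defs)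
  have invs: "inv\<^bsub>?G\<^esub> ?s = ?s" using ss s by (rule inv_equality) (rule s)
  have invr: "inv\<^bsub>?G\<^esub> ?r = ((-1) mod int N, False)"
    using N by (intro inv_equality r) (auto simp: defs mod_simps)
  have "carrier ?G \<subseteq> generate ?G {?r, ?s}"
  proof
    fix x assume x: "x \<in> carrier ?G"
    then obtain a b where ab: "x = (a, b)" "0 \<le> a" "a < int N" by (auto simp: defs)
    have g: "?r [^]\<^bsub>?G\<^esub> k \<in> generate ?G {?r, ?s}" for k :: nat
      by (induction k) (auto intro: generate.intros)
    have "(a, False) \<in> generate ?G {?r, ?s}"
      using g[of "nat a"] ab by (simp add: pow)
    moreover have "(a, True) = (a, False) \<otimes>\<^bsub>?G\<^esub> ?s" using ab by (simp add: defs)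
    ultimately show "x \<in> generate ?G {?r, ?s}"
      using ab by (cases b) (auto intro: generate.intros)
  qed
  moreover have "generate ?G {?r, ?s} \<subseteq> carrier ?G"
    using r s by (intro generate_incl) auto
  moreover have "order ?G = 2 * N"
    by (simp add: order_def defs card_cartesian_product)
  moreover have "?s \<otimes>\<^bsub>?G\<^esub> ?r \<otimes>\<^bsub>?G\<^esub> inv\<^bsub>?G\<^esub> ?s = inv\<^bsub>?G\<^esub> ?r"
    unfolding invs invr by (simp add: defs mod_simps)
  moreover have "?s [^]\<^bsub>?G\<^esub> (2::nat) = \<one>\<^bsub>?G\<^esub>"
    using ss s by (simp add: numeral_2_eq_2)
  moreover have "?r [^]\<^bsub>?G\<^esub> N = \<one>\<^bsub>?G\<^esub>"
    by (simp add: pow) (simp add: defs)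
  ultimately show ?thesis
    unfolding dihedral_def using r s is_group by blast
qed

end

theory Submission
  imports Defs
begin

text \<open>
  For odd \<open>p\<close> the conjugacy classes of subgroups are those of the cyclic groups \<open>C\<^sub>i\<close> and of the
  dihedral groups \<open>D\<^sub>i\<close> with \<open>0 \<le> i \<le> n\<close>, and conjugation acts transitively on the inclusions of
  given types. Hence a transfer system is determined by the set of its arrow types
  \<open>C\<^sub>i \<rightarrow> C\<^sub>j\<close>, \<open>C\<^sub>i \<rightarrow> D\<^sub>j\<close>, \<open>D\<^sub>i \<rightarrow> D\<^sub>j\<close>, and the possible sets are those closed under a few rules.

  Upper bound: an independent set has at most one arrow of each of the three kinds per source index.
  Let \<open>m\<close> be the largest source index of an arrow into a dihedral group. An index with an arrow
  \<open>C\<^sub>i \<rightarrow> C\<^sub>j\<close> and a further arrow is charged to the largest \<open>v\<close> such that \<open>C\<^sub>i \<rightarrow> C\<^sub>v\<close> follows from the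
  other arrows; an index with both \<open>C\<^sub>i \<rightarrow> D\<^sub>j\<close> and \<open>D\<^sub>i \<rightarrow> D\<^sub>k\<close> is charged similarly to the largest
  \<open>w\<close> with \<open>C\<^sub>i \<rightarrow> D\<^sub>w\<close>. Both charges are injective, and apart from the first kind hitting \<open>m\<close> and the
  second kind hitting \<open>w \<ge> m\<close> they hit, without overlap, only indices that are no source at all. The
  second exception occurs for at most \<open>n div 2\<close> indices: they are sources \<open>i \<le> m\<close> with distinct
  \<open>w\<close> in \<open>[m, n)\<close>, and if \<open>m\<close> is among these sources, it is hit by neither charge.

  Lower bound: with \<open>k = n div 2\<close>, take the transfer system generated by the arrows
  \<open>D\<^sub>i \<rightarrow> D\<^sub>i\<^sub>+\<^sub>1\<close> (\<open>i < k\<close>), \<open>C\<^sub>i \<rightarrow> D\<^sub>2\<^sub>k\<^sub>-\<^sub>i\<close> (\<open>i \<le> k\<close>) and \<open>C\<^sub>i \<rightarrow> C\<^sub>i\<^sub>+\<^sub>1\<close> (\<open>k \<le> i < n\<close>). It has \<open>n + k + 1\<close>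
  disjoint classes of arrows each of whose removal leaves a transfer system, so every generating
  set meets all of them.
\<close>

section \<open>Closed sets of arrow types and independent sets\<close>

text \<open>
  The conjugacy class of a subgroup is encoded as \<open>(i, b)\<close>: the rotations in it form the group of
  order \<open>p\<^sup>i\<close>, and \<open>b\<close> says whether it contains a reflection.
\<close>

type_synonym stype = "nat \<times> bool"

abbreviation CC :: "nat \<Rightarrow> nat \<Rightarrow> stype \<times> stype" where "CC i j \<equiv> ((i, False), (j, False))"
abbreviation CD :: "nat \<Rightarrow> nat \<Rightarrow> stype \<times> stype" where "CD i j \<equiv> ((i, False), (j, True))"
abbreviation DD :: "nat \<Rightarrow> nat \<Rightarrow> stype \<times> stype" where "DD i j \<equiv> ((i, True), (j, True))"

definition type_arrows :: "nat \<Rightarrow> (stype \<times> stype) set" where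
  "type_arrows n = {((i, b), (j, b')). i \<le> j \<and> j \<le> n \<and> (b \<longrightarrow> b')}"

text \<open>
  The last clause comes from two dihedral subgroups of a dihedral group that are not nested: they
  have no reflection in common. Such a pair exists exactly when both are proper.
\<close>

definition dih_closed :: "nat \<Rightarrow> (stype \<times> stype) set \<Rightarrow> bool" where
  "dih_closed n A \<longleftrightarrow>
     A \<subseteq> type_arrows n \<and>
     (\<forall>i b. i \<le> n \<longrightarrow> ((i, b), (i, b)) \<in> A) \<and>
     (\<forall>u v w. (u, v) \<in> A \<longrightarrow> (v, w) \<in> A \<longrightarrow> (u, w) \<in> A) \<and>
     (\<forall>i b j b' k b''. ((i, b), (j, b')) \<in> A \<longrightarrow> k \<le> j \<longrightarrow> (b'' \<longrightarrow> b') \<longrightarrow>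
        ((min i k, b \<and> b''), (k, b'')) \<in> A) \<and>
     (\<forall>i j k. DD i j \<in> A \<longrightarrow> i < j \<longrightarrow> k < j \<longrightarrow> CD (min i k) k \<in> A)"

lemma dih_closedI:
  assumes "A \<subseteq> type_arrows n"
    and "\<And>i b. i \<le> n \<Longrightarrow> ((i, b), (i, b)) \<in> A"
    and "\<And>i b j b' k b''. ((i, b), (j, b')) \<in> A \<Longrightarrow> ((j, b'), (k, b'')) \<in> A \<Longrightarrow>
      ((i, b), (k, b'')) \<in> A"
    and "\<And>i b j b' k b''. ((i, b), (j, b')) \<in> A \<Longrightarrow> k \<le> j \<Longrightarrow> (b'' \<longrightarrow> b') \<Longrightarrow>
      ((min i k, b \<and> b''), (k, b'')) \<in> A"
    and "\<And>i j k. DD i j \<in> A \<Longrightarrow> i < j \<Longrightarrow> k < j \<Longrightarrow> CD (min i k) k \<in> A"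
  shows "dih_closed n A"
  unfolding dih_closed_def split_paired_All using assms by (intro conjI allI impI)

context
  fixes n :: nat and A :: "(stype \<times> stype) set"
  assumes A: "dih_closed n A"
begin

lemma dih_closed_arrow: "((i, b), (j, b')) \<in> A \<Longrightarrow> i \<le> j \<and> j \<le> n \<and> (b \<longrightarrow> b')"
  using A[unfolded dih_closed_def, THEN conjunct1] by (auto simp: type_arrows_def)

lemma dih_closed_refl: "i \<le> n \<Longrightarrow> ((i, b), (i, b)) \<in> A"
  using A by (simp add: dih_closed_def)

lemma dih_closed_trans: "(u, v) \<in> A \<Longrightarrow> (v, w) \<in> A \<Longrightarrow> (u, w) \<in> A"
  using A[unfolded dih_closed_def, THEN conjunct2, THEN conjunct2, THEN conjunct1] by blast

lemma dih_closed_restrict: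
  "((i, b), (j, b')) \<in> A \<Longrightarrow> k \<le> j \<Longrightarrow> (b'' \<longrightarrow> b') \<Longrightarrow> ((min i k, b \<and> b''), (k, b'')) \<in> A"
  using A[unfolded dih_closed_def, THEN conjunct2, THEN conjunct2, THEN conjunct2, THEN conjunct1]
  by blast

lemma dih_closed_twist: "DD i j \<in> A \<Longrightarrow> i < j \<Longrightarrow> k < j \<Longrightarrow> CD (min i k) k \<in> A"
  using A[unfolded dih_closed_def, THEN conjunct2, THEN conjunct2, THEN conjunct2, THEN conjunct2]
  by blast

lemma dih_closed_CC: "((i, b), (j, b')) \<in> A \<Longrightarrow> i \<le> k \<Longrightarrow> k \<le> j \<Longrightarrow> CC i k \<in> A"
  using dih_closed_restrict[of i b j b' k False] by (simp add: min_absorb1)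

lemma dih_closed_CD: "CD i j \<in> A \<Longrightarrow> i \<le> k \<Longrightarrow> k \<le> j \<Longrightarrow> CD i k \<in> A"
  using dih_closed_restrict[of i False j True k True] by (simp add: min_absorb1)

text \<open>For \<open>k\<close> at most \<open>i\<close>, restricting to a dihedral group of level
  \<open>k\<close> also cuts the source down to level \<open>k\<close>.\<close>

lemma dih_closed_CD_diag: "CD i j \<in> A \<Longrightarrow> k \<le> i \<Longrightarrow> CD k k \<in> A"
  using dih_closed_restrict[of i False j True k True] dih_closed_arrow[of i False j True]
  by (simp add: min_absorb2)

lemma dih_closed_DD: "DD i j \<in> A \<Longrightarrow> i \<le> k \<Longrightarrow> k \<le> j \<Longrightarrow> DD i k \<in> A"
  using dih_closed_restrict[of i True j True k True] by (simp add: min_absorb1)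

text \<open>Twisting with \<open>k = i\<close> gives \<open>CD i i\<close>, and
  \<open>DD i j\<close> composes with it.\<close>

lemma dih_closed_DD_imp_CD: "DD i j \<in> A \<Longrightarrow> i < j \<Longrightarrow> CD i j \<in> A"
  using dih_closed_twist[of i j i] dih_closed_trans by simp

end

text \<open>\<open>T a\<close> stands for the types in the transfer system generated by the members
  of \<open>S\<close> other than \<open>a\<close>. The axioms keep only what the counting needs: a
  closed set that contains those members and misses \<open>a\<close>.\<close>

locale dih_independent =
  fixes n :: nat and S :: "(stype \<times> stype) set" and T :: "stype \<times> stype \<Rightarrow> (stype \<times> stype) set"
  assumes arrows: "S \<subseteq> type_arrows n"
    and closed: "a \<in> S \<Longrightarrow> dih_closed n (T a)"
    and others: "a \<in> S \<Longrightarrow> b \<in> S \<Longrightarrow> b \<noteq> a \<Longrightarrow> b \<in> T a"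
    and not_self: "a \<in> S \<Longrightarrow> a \<notin> T a"
begin

definition "cs = {i. \<exists>j. CC i j \<in> S}"
definition "xs = {i. \<exists>j. CD i j \<in> S}"
definition "ds = {i. \<exists>j. DD i j \<in> S}"

definition "tc i = (THE j. CC i j \<in> S)"
definition "tx i = (THE j. CD i j \<in> S)"
definition "td i = (THE j. DD i j \<in> S)"

text \<open>The shorter of two arrows with a common source is a restriction of the longer one, so it
  would survive its own deletion.\<close>

lemma CC_unique: "CC i j \<in> S \<Longrightarrow> CC i k \<in> S \<Longrightarrow> j = k"
proof (induction j k rule: linorder_wlog)
  case (le j k)
  have "i \<le> j" using arrows le(2) by (auto simp: type_arrows_def)
  then show ?case
    using not_self[OF le(2)] others[OF le(2) le(3)] dih_closed_CC[OF closed[OF le(2)]] le(1) by blast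
qed auto

lemma CD_unique: "CD i j \<in> S \<Longrightarrow> CD i k \<in> S \<Longrightarrow> j = k"
proof (induction j k rule: linorder_wlog)
  case (le j k)
  have "i \<le> j" using arrows le(2) by (auto simp: type_arrows_def)
  then show ?case
    using not_self[OF le(2)] others[OF le(2) le(3)] dih_closed_CD[OF closed[OF le(2)]] le(1) by blast
qed auto

lemma DD_unique: "DD i j \<in> S \<Longrightarrow> DD i k \<in> S \<Longrightarrow> j = k"
proof (induction j k rule: linorder_wlog)
  case (le j k)
  have "i \<le> j" using arrows le(2) by (auto simp: type_arrows_def)
  then show ?case
    using not_self[OF le(2)] others[OF le(2) le(3)] dih_closed_DD[OF closed[OF le(2)]] le(1) by blast
qed auto

lemma tc: "i \<in> cs \<Longrightarrow> CC i (tc i) \<in> S"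
  unfolding cs_def tc_def using theI'[of "\<lambda>j. CC i j \<in> S"] CC_unique by blast

lemma tx: "i \<in> xs \<Longrightarrow> CD i (tx i) \<in> S"
  unfolding xs_def tx_def using theI'[of "\<lambda>j. CD i j \<in> S"] CD_unique by blast

lemma td: "i \<in> ds \<Longrightarrow> DD i (td i) \<in> S"
  unfolding ds_def td_def using theI'[of "\<lambda>j. DD i j \<in> S"] DD_unique by blast

lemma S_split: "S = (\<lambda>i. CC i (tc i)) ` cs \<union> (\<lambda>i. CD i (tx i)) ` xs \<union> (\<lambda>i. DD i (td i)) ` ds"
  (is "S = ?R")
proof
  show "S \<subseteq> ?R"
  proof
    fix a assume a: "a \<in> S"
    obtain i b j b' where ab: "a = ((i, b), (j, b'))" by (metis surj_pair)
    have bb: "b \<longrightarrow> b'" using a arrows ab by (auto simp: type_arrows_def)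
    consider "a = CC i j" | "a = CD i j" | "a = DD i j" using ab bb by (cases b; cases b') auto
    then show "a \<in> ?R"
    proof cases
      case 1
      then have "i \<in> cs" using a by (auto simp: cs_def)
      then show ?thesis using CC_unique[OF tc] a 1 by blast
    next
      case 2
      then have "i \<in> xs" using a by (auto simp: xs_def)
      then show ?thesis using CD_unique[OF tx] a 2 by blast
    next
      case 3
      then have "i \<in> ds" using a by (auto simp: ds_def)
      then show ?thesis using DD_unique[OF td] a 3 by blast
    qed
  qed
qed (use tc tx td in blast)

lemma tc_bounds: "i \<in> cs \<Longrightarrow> i < tc i \<and> tc i \<le> n"
proof -
  assume i: "i \<in> cs"
  have "i \<le> tc i" "tc i \<le> n" using arrows tc[OF i] by (auto simp: type_arrows_def)
  moreover have "tc i \<noteq> i"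
    using not_self[OF tc[OF i]] dih_closed_refl[OF closed[OF tc[OF i]]] calculation by metis
  ultimately show ?thesis by simp
qed

lemma td_bounds: "i \<in> ds \<Longrightarrow> i < td i \<and> td i \<le> n"
proof -
  assume i: "i \<in> ds"
  have "i \<le> td i" "td i \<le> n" using arrows td[OF i] by (auto simp: type_arrows_def)
  moreover have "td i \<noteq> i"
    using not_self[OF td[OF i]] dih_closed_refl[OF closed[OF td[OF i]]] calculation by metis
  ultimately show ?thesis by simp
qed

lemma tx_bounds: "i \<in> xs \<Longrightarrow> i \<le> tx i \<and> tx i \<le> n"
  using arrows tx by (auto simp: type_arrows_def)

lemma finites: "finite cs" "finite xs" "finite ds"
  using tc_bounds tx_bounds td_bounds by (auto intro!: finite_subset[of _ "{..n}"]) fastforce+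

lemma card_S: "card S = card (cs \<union> (xs \<union> ds)) + card (cs \<inter> (xs \<union> ds)) + card (xs \<inter> ds)"
proof -
  let ?C = "(\<lambda>i. CC i (tc i)) ` cs" and ?X = "(\<lambda>i. CD i (tx i)) ` xs"
    and ?D = "(\<lambda>i. DD i (td i)) ` ds"
  have "card (?C \<union> ?X) = card ?C + card ?X"
    using finites by (intro card_Un_disjoint) auto
  moreover have "card (?C \<union> ?X \<union> ?D) = card (?C \<union> ?X) + card ?D"
    using finites by (intro card_Un_disjoint) auto
  ultimately have "card S = card ?C + card ?X + card ?D"
    unfolding S_split[symmetric] by simp
  also have "\<dots> = card cs + card xs + card ds"
    by (simp add: card_image inj_on_def)
  also have "card xs + card ds = card (xs \<union> ds) + card (xs \<inter> ds)"
    using finites by (intro card_Un_Int)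
  ultimately show ?thesis
    using card_Un_Int[of cs "xs \<union> ds"] finites by simp
qed

definition "m = Max (xs \<union> ds)"

lemma le_m: "i \<in> xs \<union> ds \<Longrightarrow> i \<le> m"
  unfolding m_def using finites by simp

lemma m_mem: "xs \<union> ds \<noteq> {} \<Longrightarrow> m \<in> xs \<union> ds"
  unfolding m_def using finites by (intro Max_in) auto

text \<open>An arrow from source \<open>m\<close> into a dihedral group differs from
  \<open>a\<close> and so survives in \<open>T a\<close>. It yields some \<open>CD m k\<close>,
  which restricts to the diagonal arrows at all levels up to \<open>m\<close>.\<close>

lemma CD_diag:
  assumes a: "a \<in> S" "fst (fst a) \<noteq> m" and t: "t \<le> m" and ne: "xs \<union> ds \<noteq> {}"
  shows "CD t t \<in> T a"
proof -
  note cl = closed[OF a(1)]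
  have "\<exists>k. CD m k \<in> T a"
  proof (cases "m \<in> xs")
    case True
    then show ?thesis using others[OF a(1) tx[OF True]] a(2) by fastforce
  next
    case False
    then have d: "m \<in> ds" using m_mem[OF ne] by simp
    then have "DD m (td m) \<in> T a" using others[OF a(1) td[OF d]] a(2) by fastforce
    then show ?thesis using dih_closed_DD_imp_CD[OF cl] td_bounds[OF d] by blast
  qed
  then show ?thesis using dih_closed_CD_diag[OF cl] t by blast
qed

text \<open>By \<open>CD_diag\<close>, a diagonal arrow \<open>CD i i\<close> with \<open>i\<close>
  other than \<open>m\<close> already follows from the remaining arrows.\<close>

lemma tx_diag: "i \<in> xs \<Longrightarrow> tx i = i \<Longrightarrow> i = m"
  using CD_diag[of "CD i i" i] tx[of i] not_self le_m[of i] by fastforce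

text \<open>
  \<open>rc i\<close> and \<open>rx i\<close> measure how far the remaining arrows of \<open>S\<close> reach from the source \<open>i\<close> once
  the arrow \<open>CC i (tc i)\<close>, respectively \<open>CD i (tx i)\<close>, is deleted.
\<close>

definition "rc i = Max {j. CC i j \<in> T (CC i (tc i))}"
definition "rx i = Max {j. CD i j \<in> T (CD i (tx i))}"

lemma rc:
  assumes i: "i \<in> cs"
  shows "CC i (rc i) \<in> T (CC i (tc i))" "CC i j \<in> T (CC i (tc i)) \<Longrightarrow> j \<le> rc i"
    "i \<le> rc i" "rc i < tc i"
proof -
  note cl = closed[OF tc[OF i]]
  let ?J = "{j. CC i j \<in> T (CC i (tc i))}"
  have "?J \<subseteq> {..n}" using dih_closed_arrow[OF cl] by blast
  then have fin: "finite ?J" using finite_subset by blast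
  have "i \<in> ?J" using dih_closed_refl[OF cl] tc_bounds[OF i] by simp
  then show mem: "CC i (rc i) \<in> T (CC i (tc i))" and "i \<le> rc i"
    unfolding rc_def using Max_in[OF fin] Max_ge[OF fin] by auto
  show "j \<le> rc i" if "CC i j \<in> T (CC i (tc i))"
    unfolding rc_def using Max_ge[OF fin] that by simp
  show "rc i < tc i"
    using dih_closed_CC[OF cl mem, of "tc i"] not_self[OF tc[OF i]] tc_bounds[OF i] by force
qed

text \<open>\<open>DD i (td i)\<close> outlives the deletion of \<open>CD i (tx i)\<close> and gives
  \<open>CD i (td i)\<close>, hence \<open>i < rx i\<close>. Reaching \<open>tx i\<close> would
  recover the deleted arrow by restriction.\<close>

lemma rx:
  assumes i: "i \<in> xs \<inter> ds"
  shows "CD i (rx i) \<in> T (CD i (tx i))" "CD i j \<in> T (CD i (tx i)) \<Longrightarrow> j \<le> rx i"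
    "i < rx i" "rx i < tx i"
proof -
  have ix: "i \<in> xs" and id: "i \<in> ds" using i by auto
  note cl = closed[OF tx[OF ix]]
  let ?J = "{j. CD i j \<in> T (CD i (tx i))}"
  have "?J \<subseteq> {..n}" using dih_closed_arrow[OF cl] by blast
  then have fin: "finite ?J" using finite_subset by blast
  have "td i \<in> ?J"
    using dih_closed_DD_imp_CD[OF cl] others[OF tx[OF ix] td[OF id]] td_bounds[OF id] by simp
  then show mem: "CD i (rx i) \<in> T (CD i (tx i))" and "i < rx i"
    unfolding rx_def using Max_in[OF fin] Max_ge[OF fin, of "td i"] td_bounds[OF id] by auto
  show "j \<le> rx i" if "CD i j \<in> T (CD i (tx i))"
    unfolding rx_def using Max_ge[OF fin] that by simp
  show "rx i < tx i"
    using dih_closed_CD[OF cl mem, of "tx i"] not_self[OF tx[OF ix]] tx_bounds[OF ix] by force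
qed

text \<open>No remaining arrow leaves the interval from \<open>i\<close> to \<open>rc i\<close>:
  composed with \<open>CC i u\<close>, its restriction to cyclic groups would exceed the
  maximum.\<close>

lemma rc_reach:
  assumes i: "i \<in> cs" and u: "i \<le> u" "u \<le> rc i" and b: "((u, b), (j, b')) \<in> S"
    and ne: "((u, b), (j, b')) \<noteq> CC i (tc i)"
  shows "j \<le> rc i"
proof -
  note cl = closed[OF tc[OF i]]
  have "u \<le> j" using b arrows by (auto simp: type_arrows_def)
  then have "CC u j \<in> T (CC i (tc i))"
    using dih_closed_CC[OF cl others[OF tc[OF i] b ne]] by simp
  then show ?thesis
    using rc(2)[OF i] dih_closed_trans[OF cl dih_closed_CC[OF cl rc(1)[OF i] u]] by blast
qed

lemma rx_reach_CD:
  assumes i: "i \<in> xs \<inter> ds" and u: "i < u" "u \<le> rx i" and b: "CD u j \<in> S"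
  shows "j \<le> rx i"
proof -
  have ix: "i \<in> xs" using i by auto
  note cl = closed[OF tx[OF ix]]
  have "CD u j \<in> T (CD i (tx i))" using others[OF tx[OF ix] b] u by simp
  then show ?thesis
    using rx(2)[OF i] dih_closed_trans[OF cl dih_closed_CC[OF cl rx(1)[OF i]]] u less_imp_le by blast
qed

text \<open>A cyclic arrow beyond \<open>rx i\<close> could be cut at a level \<open>t\<close> and
  continued by the diagonal arrow \<open>CD t t\<close>, against the maximality of
  \<open>rx i\<close>.\<close>

lemma rx_reach_CC:
  assumes i: "i \<in> xs \<inter> ds" and u: "i < u" "u \<le> rx i" and b: "CC u j \<in> S" and "rx i < m"
  shows "j \<le> rx i"
proof (rule ccontr)
  assume j: "\<not> j \<le> rx i"
  have ix: "i \<in> xs" using i by auto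
  note cl = closed[OF tx[OF ix]]
  \<comment> \<open>This level is still above \<open>rx i\<close>, yet small enough for
    \<open>CD_diag\<close> to apply.\<close>
  define t where "t = min j m"
  have t: "rx i < t" "t \<le> j" "t \<le> m" using j assms(5) by (auto simp: t_def)
  have "CC u j \<in> T (CD i (tx i))" using others[OF tx[OF ix] b] by simp
  then have "CC i j \<in> T (CD i (tx i))"
    using dih_closed_trans[OF cl dih_closed_CC[OF cl rx(1)[OF i]]] u less_imp_le by blast
  then have "CC i t \<in> T (CD i (tx i))"
    using dih_closed_CC[OF cl] t u by fastforce
  moreover have "CD t t \<in> T (CD i (tx i))"
    using CD_diag[OF tx[OF ix], of t] t u assms(5) ix by auto
  ultimately have "CD i t \<in> T (CD i (tx i))" using dih_closed_trans[OF cl] by blast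
  then show False using rx(2)[OF i] t by fastforce
qed

lemma rx_not_ds:
  assumes i: "i \<in> xs \<inter> ds"
  shows "rx i \<notin> ds"
proof
  assume d: "rx i \<in> ds"
  have ix: "i \<in> xs" using i by auto
  have "DD (rx i) (td (rx i)) \<in> T (CD i (tx i))"
    using others[OF tx[OF ix] td[OF d]] by simp
  then have "CD i (td (rx i)) \<in> T (CD i (tx i))"
    using dih_closed_trans[OF closed[OF tx[OF ix]] rx(1)[OF i]] by blast
  then show False using rx(2)[OF i] td_bounds[OF d] by fastforce
qed

lemma rc_not_ds:
  assumes i: "i \<in> cs"
  shows "rc i \<notin> ds"
  using rc_reach[OF i rc(3)[OF i], of True "td (rc i)" True] td td_bounds by force

text \<open>If \<open>i < j\<close> had the same value, then \<open>j\<close> would lie in the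
  interval of \<open>i\<close>, so \<open>tc j\<close> would be at most \<open>rc i = rc j\<close>,
  against \<open>rc j < tc j\<close>.\<close>

lemma inj_rc: "inj_on rc cs"
proof (rule inj_onI)
  fix i j assume "i \<in> cs" "j \<in> cs" "rc i = rc j"
  then show "i = j"
  proof (induction i j rule: linorder_wlog)
    case (le i j)
    then show ?case
      using rc_reach[OF le(2), of j False "tc j" False] tc[OF le(3)] rc(3,4)[OF le(3)] by force
  qed auto
qed

lemma inj_rx: "inj_on rx (xs \<inter> ds)"
proof (rule inj_onI)
  fix i j assume "i \<in> xs \<inter> ds" "j \<in> xs \<inter> ds" "rx i = rx j"
  then show "i = j"
  proof (induction i j rule: linorder_wlog)
    case (le i j)
    then show ?case
      using rx_reach_CD[OF le(2), of j "tx j"] tx[of j] rx(3,4)[OF le(3)] by force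
  qed auto
qed

lemma rc_unused:
  assumes i: "i \<in> cs \<inter> (xs \<union> ds)" and "rc i \<noteq> m"
  shows "rc i \<notin> cs \<union> (xs \<union> ds)"
proof -
  have ic: "i \<in> cs" using i by simp
  \<comment> \<open>An arrow from \<open>rc i\<close> into a dihedral group would have to end at
    level \<open>rc i\<close> itself, which \<open>tx_diag\<close> allows only at
    \<open>m\<close>.\<close>
  have x: "rc i \<notin> xs"
    using rc_reach[OF ic rc(3)[OF ic] order_refl tx[of "rc i"]] tx_bounds[of "rc i"]
      tx_diag[of "rc i"] assms(2) by force
  moreover have "rc i \<notin> cs"
  proof
    assume u: "rc i \<in> cs"
    show False
    proof (cases "rc i = i")
      case False
      then show False
        using rc_reach[OF ic rc(3)[OF ic] order_refl tc[OF u]] tc_bounds[OF u] by simp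
    next
      \<comment> \<open>Here the cyclic arrow at \<open>rc i\<close> is the deleted one, so
        \<open>rc_reach\<close> says nothing about it; the contradiction comes from the second arrow
        at \<open>i\<close>.\<close>
      case True
      then show False using x rc_not_ds[OF ic] i by simp
    qed
  qed
  ultimately show ?thesis using rc_not_ds[OF ic] by simp
qed

lemma rx_unused:
  assumes i: "i \<in> xs \<inter> ds" and "rx i < m"
  shows "rx i \<notin> cs \<union> (xs \<union> ds)"
proof -
  have "rx i \<notin> xs"
    using rx_reach_CD[OF i rx(3)[OF i] order_refl tx[of "rx i"]] tx_bounds[of "rx i"]
      tx_diag[of "rx i"] assms(2) by force
  moreover have "rx i \<notin> cs"
    using rx_reach_CC[OF i rx(3)[OF i] order_refl tc[of "rx i"] assms(2)] tc_bounds[of "rx i"]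
    by force
  ultimately show ?thesis using rx_not_ds[OF i] by simp
qed

text \<open>Suppose both charges hit the same index below \<open>m\<close>. If \<open>i\<close> were
  in \<open>xs\<close>, then \<open>CC i (tc i)\<close> and the diagonal arrow at
  \<open>tx i\<close> would recover \<open>CD i (tx i)\<close>. So \<open>i\<close> and
  \<open>j\<close> differ, and an arrow at the larger one leaves the interval that the smaller one
  closes off.\<close>

lemma rc_neq_rx:
  assumes i: "i \<in> cs \<inter> (xs \<union> ds)" and j: "j \<in> xs \<inter> ds" and "rx j < m"
  shows "rc i \<noteq> rx j"
proof
  assume eq: "rc i = rx j"
  have ic: "i \<in> cs" and jx: "j \<in> xs" using i j by simp_all
  have "i \<notin> xs"
  proof
    assume ix: "i \<in> xs"
    note cl = closed[OF tx[OF ix]]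
    have le: "tx i \<le> rc i"
      using rc_reach[OF ic order_refl rc(3)[OF ic] tx[OF ix]] by simp
    have "CC i (tc i) \<in> T (CD i (tx i))" using others[OF tx[OF ix] tc[OF ic]] by simp
    then have "CC i (tx i) \<in> T (CD i (tx i))"
      using dih_closed_CC[OF cl] le rc(4)[OF ic] tx_bounds[OF ix] by fastforce
    moreover have "CD (tx i) (tx i) \<in> T (CD i (tx i))"
      using CD_diag[OF tx[OF ix], of "tx i"] le eq assms(3) rc(3)[OF ic] ix by auto
    ultimately show False using dih_closed_trans[OF cl] not_self[OF tx[OF ix]] by blast
  qed
  then consider "i < j" | "j < i" using jx by (metis linorder_neqE_nat)
  then show False
  proof cases
    case 1
    then show False
      using rc_reach[OF ic, of j False "tx j" True] tx[OF jx] eq rx(3,4)[OF j] by force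
  next
    case 2
    then show False
      using rx_reach_CC[OF j, of i "tc i"] tc[OF ic] eq rc(3,4)[OF ic] assms(3) by force
  qed
qed

lemma card_le: "card S \<le> n + n div 2 + 1"
proof (cases "xs \<union> ds = {}")
  case True
  have "cs \<subseteq> {..<n}" using tc_bounds by fastforce
  then have "card cs \<le> n" using card_mono[of "{..<n}" cs] by simp
  then show ?thesis using card_S True by simp
next
  case ne: False
  define U where "U = cs \<union> (xs \<union> ds)"
  define P where "P = cs \<inter> (xs \<union> ds)"
  define Q where "Q = xs \<inter> ds"
  have fin: "finite U" "finite P" "finite Q" using finites by (auto simp: U_def P_def Q_def)
  have mn: "m \<le> n" using m_mem[OF ne] tx_bounds td_bounds by fastforce
  have Un: "U \<subseteq> {..n}" using tc_bounds tx_bounds td_bounds unfolding U_def by fastforce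
  have P: "rc i < n" if "i \<in> P" for i
    using rc(4)[of i] tc_bounds[of i] that by (auto simp: P_def)
  have Q: "rx i < n" "i \<le> m" if "i \<in> Q" for i
    using rx(4)[of i] tx_bounds[of i] le_m[of i] that by (auto simp: Q_def)
  have injP: "inj_on rc P" using inj_rc by (rule inj_on_subset) (auto simp: P_def)
  have injQ: "inj_on rx Q" using inj_rx by (simp add: Q_def)
  define P0 where "P0 = {i \<in> P. rc i \<noteq> m}"
  define P1 where "P1 = {i \<in> P. rc i = m}"
  define Q0 where "Q0 = {i \<in> Q. rx i < m}"
  define Q1 where "Q1 = {i \<in> Q. m \<le> rx i}"
  have "card P = card P0 + card P1" "card Q = card Q0 + card Q1"
    using fin by (auto simp: P0_def P1_def Q0_def Q1_def not_less[symmetric]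
        intro!: arg_cong[where f = card] card_Un_disjoint[THEN trans[rotated]])
  moreover have "card P1 \<le> 1"
  proof -
    have "inj_on rc P1" using injP by (rule inj_on_subset) (auto simp: P1_def)
    moreover have "rc ` P1 \<subseteq> {m}" by (auto simp: P1_def)
    ultimately show ?thesis using card_inj_on_le[of rc P1 "{m}"] by simp
  qed
  moreover have "card P0 + card Q0 = card (rc ` P0 \<union> rx ` Q0)"
  proof -
    have "rc ` P0 \<inter> rx ` Q0 = {}"
      using rc_neq_rx by (fastforce simp: P0_def Q0_def P_def Q_def)
    moreover have "inj_on rc P0" "inj_on rx Q0"
      using injP injQ by (auto simp: P0_def Q0_def inj_on_def)
    ultimately show ?thesis
      using fin by (simp add: card_Un_disjoint card_image P0_def Q0_def)
  qed
  \<comment> \<open>If \<open>m < n\<close>, the index \<open>n\<close> is neither a source nor hit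
    by a charge. This spare unit pays for the \<open>+ 1\<close> in the bound on
    \<open>card Q1 + card P1\<close> below.\<close>
  moreover have "card U + card (rc ` P0 \<union> rx ` Q0) + (if m < n then 1 else 0) \<le> n + 1"
  proof -
    let ?V = "rc ` P0 \<union> rx ` Q0"
    have V: "?V \<inter> U = {}" "?V \<subseteq> {..<n}"
      using rc_unused rx_unused P Q by (auto simp: P0_def Q0_def P_def Q_def U_def)
    have finV: "finite ?V" using V(2) finite_subset by blast
    have eq: "card (U \<union> ?V) = card U + card ?V"
      using fin finV V(1) by (intro card_Un_disjoint) auto
    show ?thesis
    proof (cases "m < n")
      case True
      have "n \<notin> U"
        using tc_bounds[of n] td_bounds[of n] le_m[of n] True by (auto simp: U_def)
      then have "U \<subseteq> {..n} - {n}" using Un by blast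
      also have "{..n} - {n} = {..<n}" by auto
      finally have "U \<union> ?V \<subseteq> {..<n}" using V(2) by simp
      from card_mono[OF _ this] have "card (U \<union> ?V) \<le> n" by simp
      then show ?thesis using eq True by simp
    next
      case False
      have "U \<union> ?V \<subseteq> {..n}" using Un V(2) by fastforce
      from card_mono[OF _ this] have "card (U \<union> ?V) \<le> n + 1" by simp
      then show ?thesis using eq False by simp
    qed
  qed
  moreover have "card S = card U + card P + card Q"
    using card_S by (simp add: U_def P_def Q_def)
  moreover have "card Q1 + card P1 \<le> n div 2 + 1" "m = n \<Longrightarrow> card Q1 = 0 \<and> card P1 = 0"
  proof -
    have inj: "inj_on rx Q1" using injQ by (rule inj_on_subset) (auto simp: Q1_def)
    show "card Q1 = 0 \<and> card P1 = 0" if "m = n"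
    proof -
      have "Q1 = {}" "P1 = {}" using P Q that by (fastforce simp: Q1_def P1_def)+
      then show ?thesis by simp
    qed
    show "card Q1 + card P1 \<le> n div 2 + 1"
    proof (cases "m \<in> Q")
      \<comment> \<open>Since \<open>m\<close> is in \<open>ds\<close>, neither charge hits it. At
        most \<open>m + 1\<close> sources have distinct values among \<open>n - m - 1\<close>
        indices, and the smaller of these numbers is at most \<open>n div 2\<close>.\<close>
      case True
      then have d: "m \<in> ds" by (simp add: Q_def)
      have "P1 = {}" using rc_not_ds d by (fastforce simp: P1_def P_def)
      moreover have "rx ` Q1 \<subseteq> {m<..<n}"
      proof (rule image_subsetI)
        fix i assume i: "i \<in> Q1"
        then have "rx i \<noteq> m" using rx_not_ds[of i] d by (auto simp: Q1_def Q_def)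
        then show "rx i \<in> {m<..<n}" using i Q(1)[of i] by (auto simp: Q1_def)
      qed
      then have "card Q1 \<le> n - m - 1" using card_inj_on_le[OF inj, of "{m<..<n}"] by simp
      moreover have "Q1 \<subseteq> {..m}" using Q(2) by (auto simp: Q1_def)
      from card_mono[OF _ this] have "card Q1 \<le> m + 1" by simp
      ultimately show ?thesis using mn by simp
    next
      \<comment> \<open>Now there are at most \<open>m\<close> sources and \<open>n - m\<close>
        values, and \<open>P1\<close> adds at most one.\<close>
      case False
      have "rx ` Q1 \<subseteq> {m..<n}" using Q(1) by (auto simp: Q1_def)
      then have "card Q1 \<le> n - m" using card_inj_on_le[OF inj, of "{m..<n}"] by simp
      moreover have "Q1 \<subseteq> {..m} - {m}" using Q(2) False by (auto simp: Q1_def)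
      then have "card Q1 \<le> card ({..m} - {m})" by (intro card_mono) auto
      then have "card Q1 \<le> m" by simp
      ultimately show ?thesis using \<open>card P1 \<le> 1\<close> mn by linarith
    qed
  qed
  ultimately show ?thesis using mn by (cases "m < n") auto
qed

end

section \<open>Subgroups of the dihedral group\<close>

text \<open>The generator is the least positive member of \<open>I\<close>; division with remainder
  does the rest.\<close>

lemma int_subgroup_dvd:
  fixes I :: "int set" and N :: int
  assumes diff: "\<And>x y. x \<in> I \<Longrightarrow> y \<in> I \<Longrightarrow> x - y \<in> I" and N: "N \<in> I" "N > 0"
  obtains d where "d > 0" "\<And>x. x \<in> I \<longleftrightarrow> d dvd x"
proof -
  define d where "d = (LEAST k::nat. k > 0 \<and> int k \<in> I)"
  have ex: "0 < nat N \<and> int (nat N) \<in> I" using N by simp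
  have d: "d > 0" "int d \<in> I" using LeastI[of "\<lambda>k::nat. k > 0 \<and> int k \<in> I", OF ex] by (auto simp: d_def)
  have least: "d \<le> k" if "k > 0" "int k \<in> I" for k
    unfolding d_def using that by (intro Least_le) simp
  have z: "0 \<in> I" using diff[OF N(1) N(1)] by simp
  have neg: "- x \<in> I" if "x \<in> I" for x using diff[OF z that] by simp
  have add: "x + y \<in> I" if "x \<in> I" "y \<in> I" for x y using diff[OF that(1) neg[OF that(2)]] by simp
  have natmul: "int k * int d \<in> I" for k
  proof (induction k)
    case (Suc k)
    have "int (Suc k) * int d = int k * int d + int d" by (simp add: distrib_right)
    then show ?case using add[OF Suc d(2)] by metis
  qed (simp add: z)
  have mul: "k * int d \<in> I" for k
  proof (cases "k \<ge> 0")
    case True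
    then show ?thesis using natmul[of "nat k"] by simp
  next
    case False
    then show ?thesis using neg[OF natmul[of "nat (- k)"]] by simp
  qed
  have "x \<in> I \<longleftrightarrow> int d dvd x" for x
  proof
    assume x: "x \<in> I"
    have m: "x mod int d \<in> I" using diff[OF x mul[of "x div int d"]] by (simp add: minus_div_mult_eq_mod)
    show "int d dvd x"
    proof (rule ccontr)
      assume "\<not> int d dvd x"
      then have "x mod int d \<noteq> 0" by (simp add: mod_eq_0_iff_dvd)
      moreover have "x mod int d \<ge> 0" using d(1) by simp
      ultimately have "d \<le> nat (x mod int d)" "x mod int d \<ge> 0" using m by (auto intro!: least)
      moreover have "x mod int d < int d" using d(1) by simp
      ultimately show False by linarith
    qed
  next
    assume "int d dvd x"
    then show "x \<in> I" using mul[of "x div int d"] by simp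
  qed
  then show thesis using that[of "int d"] d(1) by simp
qed

locale dihedral_prime_power =
  fixes G :: "('a, 'b) monoid_scheme" (structure) and r s :: 'a and p n :: nat
  assumes prime_p: "Factorial_Ring.prime p" and odd_p: "odd p" and dih: "dihedral G (p ^ n) r s"

sublocale dihedral_prime_power \<subseteq> group G
  using dih by (simp add: dihedral_def)

context dihedral_prime_power
begin

section \<open>Normal forms of the group elements\<close>

definition rot :: "int \<Rightarrow> 'a" where "rot x = r [^] x"
definition ref :: "int \<Rightarrow> 'a" where "ref x = rot x \<otimes> s"

text \<open>For \<open>i \<le> n\<close>, the element \<open>rot (P i)\<close> generates the
  rotation group of order \<open>p ^ i\<close>; larger levels correspond to smaller
  exponents.\<close>

abbreviation P :: "nat \<Rightarrow> int" where "P i \<equiv> int p ^ (n - i)"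

lemma r_closed [simp]: "r \<in> carrier G" and s_closed [simp]: "s \<in> carrier G"
  using dih by (auto simp: dihedral_def)

lemma rot_closed [simp]: "rot x \<in> carrier G" and ref_closed [simp]: "ref x \<in> carrier G"
  by (auto simp: rot_def ref_def)

lemma rot_0 [simp]: "rot 0 = \<one>"
  by (simp add: rot_def)

lemma rot_rot: "rot x \<otimes> rot y = rot (x + y)"
  by (simp add: rot_def int_pow_mult)

lemma inv_rot: "inv (rot x) = rot (- x)"
  by (simp add: rot_def int_pow_neg)

lemma s_s: "s \<otimes> s = \<one>"
  using dih by (simp add: dihedral_def numeral_2_eq_2)

lemma inv_s: "inv s = s"
  using s_s by (simp add: inv_equality)

lemma s_rot: "s \<otimes> rot x = rot (- x) \<otimes> s"
proof -
  let ?f = "\<lambda>h. s \<otimes> h \<otimes> inv s"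
  have cancel: "inv s \<otimes> (s \<otimes> x) = x" if "x \<in> carrier G" for x
    using that by (simp add: m_assoc[symmetric])
  have "?f \<in> hom G G"
    by (intro homI) (simp_all add: m_assoc cancel)
  then have "?f (rot x) = ?f r [^] x"
    unfolding rot_def by (intro hom_int_pow) (auto simp: is_group)
  also have "?f r = inv r" using dih by (simp add: dihedral_def)
  also have "inv r [^] x = rot (- x)" by (simp add: rot_def int_pow_inv int_pow_neg)
  finally have "s \<otimes> rot x \<otimes> inv s \<otimes> s = rot (- x) \<otimes> s" by simp
  then show ?thesis by (simp add: m_assoc)
qed

lemma rot_ref: "rot x \<otimes> ref y = ref (x + y)"
  by (simp add: ref_def m_assoc[symmetric] rot_rot)

lemma ref_rot: "ref x \<otimes> rot y = ref (x - y)"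
  by (simp add: ref_def m_assoc s_rot) (simp add: m_assoc[symmetric] rot_rot)

lemma ref_ref: "ref x \<otimes> ref y = rot (x - y)"
proof -
  have "ref x \<otimes> ref y = ref x \<otimes> rot y \<otimes> s" by (simp add: ref_def m_assoc)
  also have "\<dots> = rot (x - y)" unfolding ref_rot by (simp add: ref_def m_assoc s_s)
  finally show ?thesis .
qed

lemma inv_ref: "inv (ref x) = ref x"
  by (intro inv_equality) (simp_all add: ref_ref)

lemmas dih_mult = rot_rot rot_ref ref_rot ref_ref inv_rot inv_ref

lemma carrier_eq: "carrier G = range rot \<union> range ref"
proof
  have "x \<in> range rot \<union> range ref" if "x \<in> generate G {r, s}" for x
    using that
  proof induction
    case one
    then show ?case using rot_0 by (metis UnI1 rangeI)
  next
    case (incl h)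
    have "r = rot 1" "s = ref 0" by (simp_all add: rot_def ref_def)
    then show ?case using incl by blast
  next
    case (inv h)
    have "inv r = rot (- 1)" "inv s = ref 0"
      by (simp_all add: rot_def ref_def int_pow_neg inv_s)
    then show ?case using inv by blast
  next
    case (eng h1 h2)
    then show ?case by (auto simp: dih_mult)
  qed
  then show "carrier G \<subseteq> range rot \<union> range ref"
    using dih by (auto simp: dihedral_def)
qed auto

lemma dih_cases:
  assumes "x \<in> carrier G" obtains y where "x = rot y" | y where "x = ref y"
  using assms carrier_eq by auto

lemma p_pos [simp]: "p > 0"
  using prime_p prime_gt_0_nat by blast

lemma rot_P: "rot (int p ^ n) = \<one>"
  using dih by (simp add: dihedral_def rot_def flip: int_pow_int)

lemma rot_mod: "rot (x mod int p ^ n) = rot x"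
proof -
  have "rot (int p ^ n * k) = \<one>" for k
    using rot_P by (simp add: rot_def flip: int_pow_pow)
  then have "rot (x mod int p ^ n + int p ^ n * (x div int p ^ n)) = rot (x mod int p ^ n)"
    unfolding rot_rot[symmetric] by simp
  then show ?thesis by simp
qed

text \<open>The relations only show that \<open>2 * p ^ n\<close> normal forms exhaust the group; as
  its order is exactly this number, the forms are distinct.\<close>

lemma rot_ref_inj:
  shows rot_eq_iff: "rot x = rot y \<longleftrightarrow> int p ^ n dvd x - y"
    and ref_eq_iff: "ref x = ref y \<longleftrightarrow> int p ^ n dvd x - y"
    and rot_neq_ref: "rot x \<noteq> ref z"
proof -
  define J where "J = {0..<int p ^ n}"
  have J: "finite J" "card J = p ^ n" by (simp_all add: J_def nat_power_eq)
  have mem: "x mod int p ^ n \<in> J" for x by (simp add: J_def)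
  have "carrier G \<subseteq> rot ` J \<union> ref ` J"
  proof
    fix x assume "x \<in> carrier G"
    then show "x \<in> rot ` J \<union> ref ` J"
    proof (cases rule: dih_cases)
      case (1 y)
      then show ?thesis using mem rot_mod by (metis UnI1 imageI)
    next
      case (2 y)
      then have "x = ref (y mod int p ^ n)" by (simp add: ref_def rot_mod)
      then show ?thesis using mem by blast
    qed
  qed
  then have "carrier G = rot ` J \<union> ref ` J" by auto
  then have "card (rot ` J \<union> ref ` J) = 2 * p ^ n"
    using dih unfolding dihedral_def order_def by metis
  moreover have "card (rot ` J) \<le> p ^ n" "card (ref ` J) \<le> p ^ n"
    using card_image_le[OF J(1)] J(2) by metis+
  moreover have "card (rot ` J \<union> ref ` J) + card (rot ` J \<inter> ref ` J) = card (rot ` J) + card (ref ` J)"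
    using J(1) by (intro card_Un_Int[symmetric]) auto
  ultimately have c: "card (rot ` J) = card J" "card (rot ` J \<inter> ref ` J) = 0"
    using J(2) by linarith+
  have inj: "inj_on rot J" using eq_card_imp_inj_on[OF J(1) c(1)] .
  have disj: "rot ` J \<inter> ref ` J = {}" using c(2) J(1) by simp
  show eq: "rot x = rot y \<longleftrightarrow> int p ^ n dvd x - y" for x y
    using inj_on_eq_iff[OF inj mem mem, of x y]
    by (simp add: rot_mod mod_eq_dvd_iff)
  show "ref x = ref y \<longleftrightarrow> int p ^ n dvd x - y"
    by (simp add: ref_def eq)
  show "rot x \<noteq> ref z"
    using disj mem[of x] mem[of z] rot_mod[of x] rot_mod[of z] unfolding ref_def
    by (metis (no_types, lifting) disjoint_iff imageI)
qed

declare rot_neq_ref [simp] rot_neq_ref [symmetric, simp]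

section \<open>Subgroups described by level and reflections\<close>

definition level :: "'a set \<Rightarrow> nat" where "level H = Max {i. i \<le> n \<and> rot (P i) \<in> H}"
definition has_ref :: "'a set \<Rightarrow> bool" where "has_ref H \<longleftrightarrow> (\<exists>x. ref x \<in> H)"

lemma P_dvd_iff: "i \<le> n \<Longrightarrow> j \<le> n \<Longrightarrow> P j dvd P i \<longleftrightarrow> i \<le> j"
  using prime_gt_1_nat[OF prime_p] dvd_power_iff_le[of p "n - j" "n - i"]
  unfolding of_nat_power[symmetric] int_dvd_int_iff by linarith

lemma P_dvd_mono: "i \<le> j \<Longrightarrow> P j dvd P i"
  by (simp add: le_imp_power_dvd)

lemma P_dvd_min: "P i dvd x \<and> P j dvd x \<longleftrightarrow> P (min i j) dvd x"
  using dvd_trans P_dvd_mono[of i j] P_dvd_mono[of j i] by (metis min_def nat_le_linear)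

lemma level_eq:
  assumes "i \<le> n" "\<And>x. rot x \<in> H \<longleftrightarrow> P i dvd x"
  shows "level H = i"
proof -
  have "{j. j \<le> n \<and> rot (P j) \<in> H} = {..i}"
    using assms P_dvd_iff by fastforce
  then show ?thesis by (auto simp: level_def intro!: Max_eqI)
qed

text \<open>The exponents of the rotations in \<open>H\<close> form a subgroup of the integers
  containing \<open>p ^ n\<close>; its generator divides \<open>p ^ n\<close> and is therefore a
  power of \<open>p\<close>.\<close>

lemma subgroup_level:
  assumes H: "subgroup H G"
  shows "level H \<le> n \<and> (\<forall>x. rot x \<in> H \<longleftrightarrow> P (level H) dvd x)"
proof -
  have "rot (x - y) \<in> H" if "rot x \<in> H" "rot y \<in> H" for x y
    using subgroup.m_closed[OF H that(1) subgroup.m_inv_closed[OF H that(2)]]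
    by (simp add: dih_mult)
  moreover have "rot (int p ^ n) \<in> H" using subgroup.one_closed[OF H] by (simp add: rot_P)
  ultimately obtain d where d: "d > 0" "\<And>x. rot x \<in> H \<longleftrightarrow> d dvd x"
    using int_subgroup_dvd[of "{x. rot x \<in> H}" "int p ^ n"] by auto
  have "d dvd int p ^ n" using d(2) \<open>rot (int p ^ n) \<in> H\<close> by blast
  then have "nat d dvd p ^ n" using d(1) by (simp add: nat_dvd_iff)
  then obtain k where k: "k \<le> n" "nat d = p ^ k"
    using divides_primepow_nat[OF prime_p] by blast
  then have "d = P (n - k)" using d(1) by (simp flip: of_nat_power)
  then have "\<And>x. rot x \<in> H \<longleftrightarrow> P (n - k) dvd x" using d by simp
  moreover from this have "level H = n - k" by (intro level_eq) auto
  ultimately show ?thesis by simp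
qed

lemmas level_le = subgroup_level[THEN conjunct1]
lemmas rot_mem_iff = subgroup_level[THEN conjunct2, rule_format]

text \<open>Multiplication by \<open>ref a\<close> exchanges the reflections and the rotations of
  \<open>H\<close>.\<close>

lemma ref_mem_iff:
  assumes H: "subgroup H G" and a: "ref a \<in> H"
  shows "ref x \<in> H \<longleftrightarrow> P (level H) dvd x - a"
proof -
  have "ref x \<in> H \<longleftrightarrow> rot (x - a) \<in> H"
    using subgroup.m_closed[OF H _ a, of "ref x"] subgroup.m_closed[OF H _ a, of "rot (x - a)"]
    by (auto simp: dih_mult)
  then show ?thesis using rot_mem_iff[OF H] by simp
qed

lemma subgroup_le_iff:
  assumes K: "subgroup K G" and H: "subgroup H G"
  shows "K \<subseteq> H \<longleftrightarrow> level K \<le> level H \<and> (\<forall>x. ref x \<in> K \<longrightarrow> ref x \<in> H)"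
proof
  assume KH: "K \<subseteq> H"
  have "rot (P (level K)) \<in> K" using rot_mem_iff[OF K] by simp
  then have "P (level H) dvd P (level K)" using KH rot_mem_iff[OF H] by blast
  then show "level K \<le> level H \<and> (\<forall>x. ref x \<in> K \<longrightarrow> ref x \<in> H)"
    using KH P_dvd_iff level_le[OF H] level_le[OF K] by blast
next
  assume *: "level K \<le> level H \<and> (\<forall>x. ref x \<in> K \<longrightarrow> ref x \<in> H)"
  show "K \<subseteq> H"
  proof
    fix x assume x: "x \<in> K"
    then have "x \<in> carrier G" using subgroup.subset[OF K] by blast
    then show "x \<in> H"
    proof (cases rule: dih_cases)
      case (1 y)
      then show ?thesis
        using x rot_mem_iff[OF K] rot_mem_iff[OF H] P_dvd_mono * dvd_trans by blast
    qed (use x * in blast)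
  qed
qed

lemma subgroup_leI:
  assumes K: "subgroup K G" and H: "subgroup H G" and "level K \<le> level H"
    and "ref a \<in> K" "ref a \<in> H"
  shows "K \<subseteq> H"
  using assms P_dvd_mono[OF assms(3)]
  by (auto simp: subgroup_le_iff ref_mem_iff intro: dvd_trans)

lemma subgroup_le_norefI:
  assumes "subgroup K G" "subgroup H G" "level K \<le> level H" "\<not> has_ref K"
  shows "K \<subseteq> H"
  using assms by (simp add: subgroup_le_iff has_ref_def)

lemma subgroup_eqI:
  assumes K: "subgroup K G" and H: "subgroup H G" and "level K = level H"
    and "has_ref K = has_ref H" and "has_ref K \<Longrightarrow> \<exists>a. ref a \<in> K \<and> ref a \<in> H"
  shows "K = H"
proof (cases "has_ref K")
  case True
  then obtain a where a: "ref a \<in> K" "ref a \<in> H" using assms(5) by blast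
  show ?thesis
    using subgroup_leI[OF K H _ a] subgroup_leI[OF H K _ a(2,1)] assms(3) by simp
next
  case False
  then show ?thesis
    using subgroup_le_norefI[OF K H] subgroup_le_norefI[OF H K] assms(3,4) by simp
qed

lemma level_mono: "subgroup K G \<Longrightarrow> subgroup H G \<Longrightarrow> K \<subseteq> H \<Longrightarrow> level K \<le> level H"
  by (simp add: subgroup_le_iff)

lemma has_ref_mono: "K \<subseteq> H \<Longrightarrow> has_ref K \<Longrightarrow> has_ref H"
  by (auto simp: has_ref_def)

lemma level_Int:
  assumes K: "subgroup K G" and L: "subgroup L G"
  shows "level (K \<inter> L) = min (level K) (level L)"
  using level_le[OF K] by (intro level_eq) (auto simp: rot_mem_iff[OF K] rot_mem_iff[OF L] P_dvd_min)

definition cyc :: "nat \<Rightarrow> 'a set" where "cyc i = rot ` {x. P i dvd x}"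
text \<open>This is the subgroup generated by \<open>cyc i\<close> and the reflection
  \<open>ref a\<close>.\<close>

definition dihs :: "nat \<Rightarrow> int \<Rightarrow> 'a set" where "dihs i a = cyc i \<union> ref ` {x. P i dvd x - a}"

lemma rot_in_cyc: "rot x \<in> cyc i \<longleftrightarrow> P i dvd x"
proof
  assume "rot x \<in> cyc i"
  then obtain y where "rot x = rot y" "P i dvd y" by (auto simp: cyc_def)
  then have "P i dvd x - y" using rot_eq_iff le_imp_power_dvd[of "n - i" n "int p"] dvd_trans by simp blast
  then show "P i dvd x" using \<open>P i dvd y\<close> by (metis diff_add_cancel dvd_add)
qed (auto simp: cyc_def)

lemma ref_in_dihs: "ref x \<in> dihs i a \<longleftrightarrow> P i dvd x - a"
proof
  assume "ref x \<in> dihs i a"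
  then obtain y where "ref x = ref y" "P i dvd y - a"
    by (auto simp: dihs_def cyc_def)
  then have "P i dvd x - y" using ref_eq_iff le_imp_power_dvd[of "n - i" n "int p"] dvd_trans by simp blast
  then have "P i dvd (x - y) + (y - a)" using \<open>P i dvd y - a\<close> by (rule dvd_add)
  then show "P i dvd x - a" by simp
qed (auto simp: dihs_def)

lemma ref_notin_cyc: "ref x \<notin> cyc i"
  by (auto simp: cyc_def)

lemma rot_in_dihs: "rot x \<in> dihs i a \<longleftrightarrow> P i dvd x"
  by (auto simp: dihs_def rot_in_cyc)

lemma subgroup_cyc: "subgroup (cyc i) G"
proof (rule subgroupI)
  have "rot 0 \<in> cyc i" unfolding rot_in_cyc by simp
  then show "cyc i \<noteq> {}" by blast
qed (auto simp: cyc_def dih_mult)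

lemma subgroup_dihs: "subgroup (dihs i a) G"
proof (rule subgroupI)
  have "rot 0 \<in> dihs i a" unfolding rot_in_dihs by simp
  then show "dihs i a \<noteq> {}" by blast
next
  fix x y assume "x \<in> dihs i a" "y \<in> dihs i a"
  then consider u v where "x = rot u" "P i dvd u" "y = rot v" "P i dvd v"
    | u v where "x = rot u" "P i dvd u" "y = ref v" "P i dvd v - a"
    | u v where "x = ref u" "P i dvd u - a" "y = rot v" "P i dvd v"
    | u v where "x = ref u" "P i dvd u - a" "y = ref v" "P i dvd v - a"
    unfolding dihs_def cyc_def by blast
  then show "x \<otimes> y \<in> dihs i a"
  proof cases
    case 2
    then show ?thesis using dvd_add[of "P i" u "v - a"]
      by (simp add: dih_mult ref_in_dihs algebra_simps)
  next
    case 3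
    then show ?thesis using dvd_diff[of "P i" "u - a" v]
      by (simp add: dih_mult ref_in_dihs algebra_simps)
  next
    case 4
    then show ?thesis using dvd_diff[of "P i" "u - a" "v - a"]
      by (simp add: dih_mult rot_in_dihs)
  qed (simp add: dih_mult rot_in_dihs)
qed (auto simp: dihs_def cyc_def dih_mult)

lemma level_cyc: "i \<le> n \<Longrightarrow> level (cyc i) = i"
  by (rule level_eq) (auto simp: rot_in_cyc)

lemma level_dihs: "i \<le> n \<Longrightarrow> level (dihs i a) = i"
  by (rule level_eq) (auto simp: rot_in_dihs)

lemma has_ref_cyc: "\<not> has_ref (cyc i)"
  by (simp add: has_ref_def ref_notin_cyc)

lemma ref_self_dihs: "ref a \<in> dihs i a"
  by (simp add: ref_in_dihs)

lemma has_ref_dihs: "has_ref (dihs i a)"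
  using ref_self_dihs by (auto simp: has_ref_def)

section \<open>Conjugacy of subgroups and of inclusions\<close>

lemma conj_mem_iff:
  assumes g: "g \<in> carrier G" and H: "subgroup H G" and y: "y \<in> carrier G"
  shows "y \<in> conj_set G g H \<longleftrightarrow> inv g \<otimes> y \<otimes> g \<in> H"
proof -
  have sub: "H \<subseteq> carrier G" using H by (rule subgroup.subset)
  have c1: "inv g \<otimes> (g \<otimes> x) = x" "g \<otimes> (inv g \<otimes> x) = x" if "x \<in> carrier G" for x
    using that g by (simp_all add: m_assoc[symmetric])
  have "inv g \<otimes> (g \<otimes> h \<otimes> inv g) \<otimes> g = h" if "h \<in> H" for h
    using that sub g by (simp add: m_assoc c1 subset_iff)
  moreover have "y = g \<otimes> (inv g \<otimes> y \<otimes> g) \<otimes> inv g"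
    using g y by (simp add: m_assoc c1)
  ultimately show ?thesis by (auto simp: conj_set_mem[OF g sub])
qed

lemma level_conj:
  assumes g: "g \<in> carrier G" and H: "subgroup H G"
  shows "level (conj_set G g H) = level H"
  using g
proof (cases rule: dih_cases)
  case (1 y)
  then show ?thesis
    by (intro level_eq) (simp_all add: conj_mem_iff[OF _ H] dih_mult rot_mem_iff[OF H] level_le[OF H])
next
  case (2 y)
  then show ?thesis
    by (intro level_eq) (simp_all add: conj_mem_iff[OF _ H] dih_mult rot_mem_iff[OF H] level_le[OF H])
qed

lemma ref_mem_conj_rot:
  assumes H: "subgroup H G"
  shows "ref x \<in> conj_set G (rot y) H \<longleftrightarrow> ref (x - 2 * y) \<in> H"
  by (simp add: conj_mem_iff[OF _ H] dih_mult algebra_simps)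

lemma ref_mem_conj_ref:
  assumes H: "subgroup H G"
  shows "ref x \<in> conj_set G (ref y) H \<longleftrightarrow> ref (2 * y - x) \<in> H"
  by (simp add: conj_mem_iff[OF _ H] dih_mult algebra_simps)

lemma has_ref_conj:
  assumes g: "g \<in> carrier G" and H: "subgroup H G"
  shows "has_ref (conj_set G g H) = has_ref H"
  using g
proof (cases rule: dih_cases)
  case (1 y)
  have "\<exists>x. ref (x - 2 * y) \<in> H" if "ref z \<in> H" for z
    using that by (intro exI[of _ "z + 2 * y"]) simp
  then show ?thesis using 1 by (auto simp: has_ref_def ref_mem_conj_rot[OF H])
next
  case (2 y)
  have "\<exists>x. ref (2 * y - x) \<in> H" if "ref z \<in> H" for z
    using that by (intro exI[of _ "2 * y - z"]) simp
  then show ?thesis using 2 by (auto simp: has_ref_def ref_mem_conj_ref[OF H])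
qed

definition dtype :: "'a set \<Rightarrow> stype" where "dtype H = (level H, has_ref H)"

text \<open>Oddness of \<open>p\<close> makes all reflections conjugate: \<open>r\<^sup>a s\<close> is moved to \<open>r\<^sup>b s\<close> by \<open>r\<^sup>y\<close> with
  \<open>2 y \<equiv> b - a\<close>.\<close>

lemma dtype_conjugate:
  assumes sub: "subgroup K G" "subgroup H G" "subgroup K' G" "subgroup H' G"
    and le: "K \<subseteq> H" "K' \<subseteq> H'"
    and type: "dtype K' = dtype K" "dtype H' = dtype H"
  shows "\<exists>g\<in>carrier G. conj_set G g K = K' \<and> conj_set G g H = H'"
proof -
  have lv: "level K' = level K" "has_ref K' = has_ref K" "level H' = level H" "has_ref H' = has_ref H"
    using type by (auto simp: dtype_def)
  \<comment> \<open>One pair of reflections has to serve both groups of each inclusion, so it is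
    taken from the smaller ones whenever these contain reflections.\<close>
  obtain a a' where aa: "has_ref H \<Longrightarrow> ref a \<in> H \<and> ref a' \<in> H'"
    "has_ref K \<Longrightarrow> ref a \<in> K \<and> ref a' \<in> K'"
  proof (cases "has_ref K")
    case True
    then show thesis using that le lv by (metis has_ref_def subsetD)
  next
    case False
    then show thesis using that lv by (metis has_ref_def)
  qed
  \<comment> \<open>The factor \<open>(p ^ n + 1) div 2\<close> is the inverse of 2 modulo
    \<open>p ^ n\<close>.\<close>
  define y where "y = (a' - a) * int ((p ^ n + 1) div 2)"
  have "2 * ((p ^ n + 1) div 2) = p ^ n + 1" using odd_p by simp
  then have "2 * int ((p ^ n + 1) div 2) = int p ^ n + 1"
    by (metis of_nat_1 of_nat_add of_nat_mult of_nat_numeral of_nat_power)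
  then have "2 * y = (a' - a) * (int p ^ n + 1)" by (simp add: y_def mult.left_commute)
  then have "a' - 2 * y - a = int p ^ n * (a - a')" by (simp add: algebra_simps)
  then have ref: "ref (a' - 2 * y) = ref a" by (simp add: ref_eq_iff)
  have "conj_set G (rot y) B = B'"
    if "subgroup B G" "subgroup B' G" "level B' = level B" "has_ref B' = has_ref B"
      "has_ref B \<Longrightarrow> ref a \<in> B \<and> ref a' \<in> B'" for B B'
    using that ref
    by (intro subgroup_eqI)
      (auto simp: conj_set_subgroup level_conj has_ref_conj ref_mem_conj_rot intro!: exI[of _ a'])
  then show ?thesis using sub lv aa by (intro bexI[of _ "rot y"]) auto
qed

end

section \<open>Transfer systems and arrow types\<close>

lemma transfer_systemD:
  assumes "transfer_system G T"
  shows transfer_system_refl: "H \<in> Sub G \<Longrightarrow> (H, H) \<in> T"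
    and transfer_system_trans: "(L, K) \<in> T \<Longrightarrow> (K, H) \<in> T \<Longrightarrow> (L, H) \<in> T"
    and transfer_system_Int: "(K, H) \<in> T \<Longrightarrow> L \<in> Sub G \<Longrightarrow> L \<subseteq> H \<Longrightarrow> (K \<inter> L, L) \<in> T"
    and transfer_system_conj: "(K, H) \<in> T \<Longrightarrow> g \<in> carrier G \<Longrightarrow> (conj_set G g K, conj_set G g H) \<in> T"
proof -
  have po: "refl_on (Sub G) T" "trans T"
    using assms by (auto simp: transfer_system_def order_on_defs)
  show "H \<in> Sub G \<Longrightarrow> (H, H) \<in> T" using po(1) by (simp add: refl_on_def)
  show "(L, K) \<in> T \<Longrightarrow> (K, H) \<in> T \<Longrightarrow> (L, H) \<in> T" using po(2) by (rule transD)
  show "(K \<inter> L, L) \<in> T" if "(K, H) \<in> T" "L \<in> Sub G" "L \<subseteq> H"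
  proof -
    have "(K \<inter> L, H \<inter> L) \<in> T" using assms that unfolding transfer_system_def by blast
    then show ?thesis using that(3) by (simp add: Int_absorb1)
  qed
  show "(K, H) \<in> T \<Longrightarrow> g \<in> carrier G \<Longrightarrow> (conj_set G g K, conj_set G g H) \<in> T"
    using assms unfolding transfer_system_def by blast
qed

lemma ts_gen_inc: "a \<in> S \<Longrightarrow> a \<in> ts_gen G S"
  by (simp add: ts_gen_def hull_inc)

text \<open>In a generating set of least size no member is redundant.\<close>

lemma exists_minimal_generating_set:
  assumes fin: "finite (arrows G)" and T: "transfer_system G T"
  shows "\<exists>S. minimal_generating_set G T S"
proof -
  let ?gen = "\<lambda>S. S \<subseteq> arrows G \<and> ts_gen G S = T"
  have "?gen T" using transfer_system_subset_arrows[OF T] T by (simp add: ts_gen_def hull_same)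
  then obtain S where S: "?gen S" and min: "\<And>S'. ?gen S' \<Longrightarrow> card S \<le> card S'"
    using ex_has_least_nat[of ?gen T card] by blast
  have "a \<notin> ts_gen G (S - {a})" if a: "a \<in> S" for a
  proof
    assume "a \<in> ts_gen G (S - {a})"
    then have "ts_gen G (insert a (S - {a})) = ts_gen G (S - {a})"
      unfolding ts_gen_def by (rule hull_redundant)
    then have "?gen (S - {a})" using S a by (auto simp: insert_absorb)
    moreover have "card (S - {a}) < card S"
      using a S finite_subset[OF _ fin] by (intro psubset_card_mono) auto
    ultimately show False using min[of "S - {a}"] by simp
  qed
  then show ?thesis using S by (auto simp: minimal_generating_set_def)
qed

context dihedral_prime_power
begin

lemma dtype_conj: "g \<in> carrier G \<Longrightarrow> subgroup H G \<Longrightarrow> dtype (conj_set G g H) = dtype H"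
  by (simp add: dtype_def level_conj has_ref_conj)

definition atype :: "'a set \<times> 'a set \<Rightarrow> stype \<times> stype" where
  "atype a = (dtype (fst a), dtype (snd a))"

definition of_types :: "(stype \<times> stype) set \<Rightarrow> ('a set \<times> 'a set) set" where
  "of_types A = {a \<in> arrows G. atype a \<in> A}"

lemma atype_arrow: "a \<in> arrows G \<Longrightarrow> atype a \<in> type_arrows n"
  using level_mono level_le has_ref_mono
  by (auto simp: arrows_def Sub_def atype_def dtype_def type_arrows_def)

lemma arrow_conjugate:
  assumes "a \<in> arrows G" "b \<in> arrows G" "atype a = atype b"
  shows "\<exists>g\<in>carrier G. conj_set G g (fst a) = fst b \<and> conj_set G g (snd a) = snd b"
  using assms dtype_conjugate[of "fst a" "snd a" "fst b" "snd b"]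
  by (cases a; cases b) (auto simp: arrows_def Sub_def atype_def)

text \<open>Arrows of equal type are conjugate, and \<open>T\<close> is invariant under
  conjugation.\<close>

lemma transfer_system_atype:
  assumes T: "transfer_system G T" and a: "a \<in> arrows G" and t: "atype a \<in> atype ` T"
  shows "a \<in> T"
proof -
  obtain b where b: "b \<in> T" "atype b = atype a" using t by auto
  then obtain g where g: "g \<in> carrier G" "conj_set G g (fst b) = fst a" "conj_set G g (snd b) = snd a"
    using arrow_conjugate[OF _ a b(2)] transfer_system_subset_arrows[OF T] by blast
  then show ?thesis using transfer_system_conj[OF T, of "fst b" "snd b" g] b(1) by simp
qed

lemma exists_dtype: "i \<le> n \<Longrightarrow> \<exists>H. subgroup H G \<and> dtype H = (i, b)"
  using subgroup_cyc[of i] subgroup_dihs[of i 0] level_cyc[of i] level_dihs[of i 0]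
    has_ref_cyc[of i] has_ref_dihs[of i 0]
  unfolding dtype_def
  by (intro exI[of _ "if b then dihs i 0 else cyc i"]) simp

lemma exists_restriction:
  assumes K: "subgroup K G" and H: "subgroup H G" and KH: "K \<subseteq> H"
    and k: "k \<le> level H" and b: "b \<longrightarrow> has_ref H"
  shows "\<exists>L. subgroup L G \<and> L \<subseteq> H \<and> dtype L = (k, b) \<and> dtype (K \<inter> L) = (min (level K) k, has_ref K \<and> b)"
proof -
  have kn: "k \<le> n" using k level_le[OF H] by simp
  \<comment> \<open>Building \<open>L\<close> around a reflection of \<open>K\<close>, if there is
    one, keeps this reflection in \<open>K \<inter> L\<close>.\<close>
  obtain a where a: "has_ref H \<Longrightarrow> ref a \<in> H" "has_ref K \<Longrightarrow> ref a \<in> K"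
    using KH by (cases "has_ref K") (auto simp: has_ref_def subset_iff)
  show ?thesis
  proof (cases b)
    case True
    have "dihs k a \<subseteq> H"
      using subgroup_leI[OF subgroup_dihs H _ ref_self_dihs] k kn a(1) True b by (simp add: level_dihs ref_self_dihs)
    moreover have "has_ref (K \<inter> dihs k a) = has_ref K"
      using a(2) ref_self_dihs[of a k] by (auto simp: has_ref_def)
    ultimately show ?thesis
      using True kn K
      by (intro exI[of _ "dihs k a"])
        (simp add: subgroup_dihs dtype_def level_dihs has_ref_dihs level_Int)
  next
    case False
    have "cyc k \<subseteq> H"
      using subgroup_le_norefI[OF subgroup_cyc H] k kn by (simp add: level_cyc has_ref_cyc)
    moreover have "\<not> has_ref (K \<inter> cyc k)"
      using has_ref_cyc by (auto simp: has_ref_def)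
    ultimately show ?thesis
      using False kn K
      by (intro exI[of _ "cyc k"])
        (simp add: subgroup_cyc dtype_def level_cyc has_ref_cyc level_Int)
  qed
qed

lemma exists_twisted_restriction:
  assumes K: "subgroup K G" and H: "subgroup H G" and KH: "K \<subseteq> H" and ref: "has_ref K"
    and lt: "level K < level H" "k < level H"
  shows "\<exists>L. subgroup L G \<and> L \<subseteq> H \<and> dtype L = (k, True) \<and> dtype (K \<inter> L) = (min (level K) k, False)"
proof -
  obtain a where a: "ref a \<in> K" using ref by (auto simp: has_ref_def)
  have n: "level H \<le> n" using level_le[OF H] .
  \<comment> \<open>The shift by \<open>P (level H)\<close> stays inside \<open>H\<close>, but the
    rotations of \<open>K\<close> and \<open>L\<close>, both of smaller level, cannot undo it; so
    the two groups share no reflection.\<close>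
  define L where "L = dihs k (a + P (level H))"
  have L: "subgroup L G" "level L = k" "has_ref L"
    using lt(2) n by (simp_all add: L_def subgroup_dihs level_dihs has_ref_dihs)
  have "ref (a + P (level H)) \<in> H"
    using ref_mem_iff[OF H, of a] a KH by auto
  then have LH: "L \<subseteq> H"
    using subgroup_leI[OF L(1) H _ ref_self_dihs[of "a + P (level H)" k, folded L_def]] lt(2) L(2) by simp
  have "\<not> has_ref (K \<inter> L)"
  proof
    assume "has_ref (K \<inter> L)"
    then obtain x where x: "P (level K) dvd x - a" "P k dvd x - (a + P (level H))"
      using ref_mem_iff[OF K a] by (auto simp: has_ref_def L_def ref_in_dihs)
    define j where "j = max (level K) k"
    have "P j dvd x - a" "P j dvd x - (a + P (level H))"
      using x P_dvd_mono[of "level K" j] P_dvd_mono[of k j] dvd_trans by (auto simp: j_def)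
    then have "P j dvd (x - a) - (x - (a + P (level H)))" by (rule dvd_diff)
    then have "P j dvd P (level H)" by simp
    then show False using P_dvd_iff[of "level H" j] lt n by (simp add: j_def)
  qed
  then show ?thesis using L LH K by (intro exI[of _ L]) (simp add: dtype_def level_Int)
qed

lemma dih_closed_atype:
  assumes T: "transfer_system G T"
  shows "dih_closed n (atype ` T)"
  unfolding dih_closed_def
proof (intro conjI allI impI)
  note sub = transfer_system_subset_arrows[OF T]
  have arr: "\<exists>K H. (K, H) \<in> T \<and> subgroup K G \<and> subgroup H G \<and> K \<subseteq> H \<and> dtype K = u \<and> dtype H = v"
    if "(u, v) \<in> atype ` T" for u v
    using that sub by (fastforce simp: atype_def arrows_def Sub_def)
  show "atype ` T \<subseteq> type_arrows n" using sub atype_arrow by blast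
  fix i j k b b' b''
  show "((i, b), (i, b)) \<in> atype ` T" if "i \<le> n"
  proof -
    obtain H where "subgroup H G" "dtype H = (i, b)" using exists_dtype[OF \<open>i \<le> n\<close>, of b] by blast
    then show ?thesis
      using transfer_system_refl[OF T, of H] by (force simp: atype_def Sub_def)
  qed
  show "((min i k, b \<and> b''), (k, b'')) \<in> atype ` T"
    if a: "((i, b), (j, b')) \<in> atype ` T" and k: "k \<le> j" and b: "b'' \<longrightarrow> b'"
  proof -
    obtain K H where KH: "(K, H) \<in> T" "subgroup K G" "subgroup H G" "K \<subseteq> H"
      "dtype K = (i, b)" "dtype H = (j, b')" using arr[OF a] by blast
    have t: "level K = i" "has_ref K = b" "level H = j" "has_ref H = b'"
      using KH(5,6) by (auto simp: dtype_def)
    obtain L where L: "subgroup L G" "L \<subseteq> H" "dtype L = (k, b'')"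
      "dtype (K \<inter> L) = (min i k, b \<and> b'')"
      using exists_restriction[OF KH(2-4), of k b''] t k b by blast
    have "(K \<inter> L, L) \<in> T" using transfer_system_Int[OF T KH(1) _ L(2)] L(1) by (simp add: Sub_def)
    then have "atype (K \<inter> L, L) \<in> atype ` T" by (rule imageI)
    then show ?thesis using L by (simp add: atype_def)
  qed
  show "CD (min i k) k \<in> atype ` T"
    if a: "DD i j \<in> atype ` T" and lt: "i < j" "k < j"
  proof -
    obtain K H where KH: "(K, H) \<in> T" "subgroup K G" "subgroup H G" "K \<subseteq> H"
      "dtype K = (i, True)" "dtype H = (j, True)" using arr[OF a] by blast
    have t: "level K = i" "has_ref K" "level H = j"
      using KH(5,6) by (auto simp: dtype_def)
    obtain L where L: "subgroup L G" "L \<subseteq> H" "dtype L = (k, True)"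
      "dtype (K \<inter> L) = (min i k, False)"
      using exists_twisted_restriction[OF KH(2-4), of k] t lt by blast
    have "(K \<inter> L, L) \<in> T" using transfer_system_Int[OF T KH(1) _ L(2)] L(1) by (simp add: Sub_def)
    then have "atype (K \<inter> L, L) \<in> atype ` T" by (rule imageI)
    then show ?thesis using L by (simp add: atype_def)
  qed
  fix u v w
  show "(u, w) \<in> atype ` T" if uv: "(u, v) \<in> atype ` T" and vw: "(v, w) \<in> atype ` T"
  proof -
    obtain K H where KH: "(K, H) \<in> T" "subgroup H G" "dtype K = u" "dtype H = v"
      using arr[OF uv] by blast
    obtain H' L where HL: "(H', L) \<in> T" "subgroup H' G" "subgroup L G" "dtype H' = v" "dtype L = w"
      using arr[OF vw] by blast
    \<comment> \<open>The two arrows only meet in conjugate groups, so the second one is conjugated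
      until they compose.\<close>
    obtain g where g: "g \<in> carrier G" "conj_set G g H' = H"
      using dtype_conjugate[of H' H' H H] KH HL by auto
    have "(H, conj_set G g L) \<in> T" using transfer_system_conj[OF T HL(1) g(1)] g(2) by simp
    then have "(K, conj_set G g L) \<in> T" using transfer_system_trans[OF T KH(1)] by blast
    then have "atype (K, conj_set G g L) \<in> atype ` T" by (rule imageI)
    then show ?thesis using KH HL dtype_conj[OF g(1) HL(3)] by (simp add: atype_def)
  qed
qed

lemma transfer_system_of_types:
  assumes A: "dih_closed n A"
  shows "transfer_system G (of_types A)"
proof -
  have lv: "level H \<le> n" if "H \<in> Sub G" for H using that level_le by (simp add: Sub_def)
  have ts: "transfer_system G (arrows G)" by (rule transfer_system_arrows)
  have sub: "of_types A \<subseteq> arrows G" by (auto simp: of_types_def)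
  show ?thesis
    unfolding transfer_system_def
  proof (intro conjI allI ballI impI)
    have "refl_on (Sub G) (of_types A)"
      using transfer_system_refl[OF ts] dih_closed_refl[OF A] lv
      by (auto simp: refl_on_def of_types_def atype_def dtype_def)
    moreover have "trans (of_types A)"
      using transfer_system_trans[OF ts] dih_closed_trans[OF A]
      unfolding trans_def of_types_def atype_def by fastforce
    moreover have "antisym (of_types A)"
      using sub by (auto simp: antisym_def arrows_def)
    moreover have "of_types A \<subseteq> Sub G \<times> Sub G"
      using sub by (auto simp: arrows_def)
    ultimately show "partial_order_on (Sub G) (of_types A)" by (simp add: order_on_defs)
  next
    show "K \<subseteq> H" if "(K, H) \<in> of_types A" for K H
      using that sub by (auto simp: arrows_def)
  next
    fix K H L assume L: "L \<in> Sub G" and *: "(K, H) \<in> of_types A \<and> L \<subseteq> H"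
    have s: "subgroup K G" "subgroup H G" "subgroup L G" "K \<subseteq> H" "L \<subseteq> H"
      using * L sub by (auto simp: arrows_def Sub_def)
    have arr: "(K \<inter> L, L) \<in> arrows G"
      using transfer_system_Int[OF ts _ L, of K H] * sub by blast
    have KH: "((level K, has_ref K), (level H, has_ref H)) \<in> A"
      using * by (simp add: of_types_def atype_def dtype_def)
    have "((level (K \<inter> L), has_ref (K \<inter> L)), (level L, has_ref L)) \<in> A"
    \<comment> \<open>The twist clause handles the case that \<open>K\<close> and \<open>L\<close>
      both have reflections but none in common. Both then have smaller level than \<open>H\<close>,
      since a subgroup of full level with a reflection is all of \<open>H\<close>.\<close>
    proof (cases "has_ref K \<and> has_ref L \<and> \<not> has_ref (K \<inter> L)")
      case True
      have refH: "has_ref H" using True s(4) has_ref_mono by blast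
      have "level K \<noteq> level H"
      proof
        assume "level K = level H"
        then have "K = H" using True refH s by (intro subgroup_eqI) (auto simp: has_ref_def)
        then show False using True s(5) by (simp add: Int_absorb1)
      qed
      moreover have "level L \<noteq> level H"
      proof
        assume "level L = level H"
        then have "L = H" using True refH s by (intro subgroup_eqI) (auto simp: has_ref_def)
        then show False using True s(4) by (auto simp: Int_absorb2)
      qed
      ultimately show ?thesis
        using dih_closed_twist[OF A, of "level K" "level H" "level L"] KH True refH s level_mono
        by (simp add: level_Int order_less_le)
    next
      case False
      then have "has_ref (K \<inter> L) = (has_ref K \<and> has_ref L)" by (auto simp: has_ref_def)
      then show ?thesis
        using dih_closed_restrict[OF A KH, of "level L" "has_ref L"] s level_mono has_ref_mono
        by (simp add: level_Int)
    qed
    then show "(K \<inter> L, H \<inter> L) \<in> of_types A"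
      using arr s(5) by (simp add: of_types_def atype_def dtype_def Int_absorb1)
  next
    fix K H g assume g: "g \<in> carrier G" and KH: "(K, H) \<in> of_types A"
    have "subgroup K G" "subgroup H G" using KH sub by (auto simp: arrows_def Sub_def)
    then show "(conj_set G g K, conj_set G g H) \<in> of_types A"
      using KH transfer_system_conj[OF ts _ g, of K H] dtype_conj[OF g]
      by (simp add: of_types_def atype_def)
  qed
qed

lemma of_types_surj:
  assumes "\<alpha> \<in> type_arrows n"
  shows "\<exists>a\<in>arrows G. atype a = \<alpha>"
proof -
  obtain i b j b' where \<alpha>: "\<alpha> = ((i, b), (j, b'))" "i \<le> j" "j \<le> n" "b \<longrightarrow> b'"
    using assms by (auto simp: type_arrows_def)
  obtain H where H: "subgroup H G" "dtype H = (j, b')" using exists_dtype[OF \<alpha>(3), of b'] by blast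
  then obtain K where "subgroup K G" "K \<subseteq> H" "dtype K = (i, b)"
    using exists_restriction[OF H(1) H(1), of i b] \<alpha> by (auto simp: dtype_def)
  then show ?thesis
    using H \<alpha> by (intro bexI[of _ "(K, H)"]) (auto simp: atype_def arrows_def Sub_def)
qed

lemma finite_arrows: "finite (arrows G)"
proof -
  have "card (carrier G) = 2 * p ^ n" using dih unfolding dihedral_def order_def by blast
  then have "card (carrier G) > 0" by simp
  then have "finite (carrier G)" using card_gt_0_iff by blast
  moreover have "arrows G \<subseteq> Pow (carrier G) \<times> Pow (carrier G)"
    by (auto simp: arrows_def Sub_def dest: subgroup.subset)
  ultimately show ?thesis using finite_subset by blast
qed

section \<open>Bounds on the size of generating sets\<close>

lemma card_minimal_generating_set_le:
  assumes S: "minimal_generating_set G T S"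
  shows "card S \<le> n + n div 2 + 1"
proof -
  have sub: "S \<subseteq> arrows G" using S by (simp add: minimal_generating_set_def)
  have ts: "transfer_system G (ts_gen G (S - B))" for B
    using sub by (intro transfer_system_ts_gen is_group) auto
  have not: "atype a \<notin> atype ` ts_gen G (S - {a})" if "a \<in> S" for a
    using transfer_system_atype[OF ts, of a "{a}"] S that sub
    unfolding minimal_generating_set_def by blast
  \<comment> \<open>An arrow is generated by any other arrow of its type.\<close>
  have inj: "inj_on atype S"
  proof (rule inj_onI, rule ccontr)
    fix a b assume *: "a \<in> S" "b \<in> S" "atype a = atype b" "a \<noteq> b"
    then have "b \<in> ts_gen G (S - {a})" by (intro ts_gen_inc) auto
    then show False using not[OF *(1)] *(3) by simp
  qed
  \<comment> \<open>All arrows of type \<open>\<alpha>\<close> are dropped; by \<open>inj\<close>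
    this is a single arrow when \<open>\<alpha>\<close> occurs in \<open>S\<close>.\<close>
  define E where "E \<alpha> = atype ` ts_gen G (S - {b. atype b = \<alpha>})" for \<alpha>
  interpret dih_independent n "atype ` S" E
  proof
    show "atype ` S \<subseteq> type_arrows n" using sub atype_arrow by blast
    show "dih_closed n (E \<alpha>)" for \<alpha> unfolding E_def using ts by (rule dih_closed_atype)
    show "\<beta> \<in> E \<alpha>" if "\<beta> \<in> atype ` S" "\<beta> \<noteq> \<alpha>" for \<alpha> \<beta>
      using that by (auto simp: E_def intro!: imageI ts_gen_inc)
    show "\<alpha> \<notin> E \<alpha>" if "\<alpha> \<in> atype ` S" for \<alpha>
    proof -
      obtain a where a: "a \<in> S" "\<alpha> = atype a" using \<open>\<alpha> \<in> atype ` S\<close> by auto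
      then have "S - {b. atype b = \<alpha>} = S - {a}" using inj by (auto simp: inj_on_def)
      then show ?thesis using not[OF a(1)] a(2) by (simp add: E_def)
    qed
  qed
  show ?thesis using card_le inj by (simp add: card_image)
qed

text \<open>A generating set that avoids \<open>B\<close> would lie in the smaller transfer system
  \<open>of_types (A - B)\<close>. So it meets every class, and in different arrows because the
  classes are disjoint.\<close>

lemma card_generating_set_ge:
  assumes A: "dih_closed n A" and S: "S \<subseteq> arrows G" "ts_gen G S = of_types A"
    and disj: "pairwise disjnt \<B>"
    and B: "\<And>B. B \<in> \<B> \<Longrightarrow> dih_closed n (A - B) \<and> A \<inter> B \<noteq> {}"
  shows "card \<B> \<le> card S"
proof -
  have "\<exists>a\<in>S. atype a \<in> B" if "B \<in> \<B>" for B
  proof (rule ccontr)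
    assume no: "\<not> (\<exists>a\<in>S. atype a \<in> B)"
    have "S \<subseteq> of_types A" using S ts_gen_inc by blast
    then have "S \<subseteq> of_types (A - B)" using no by (auto simp: of_types_def)
    then have "ts_gen G S \<subseteq> of_types (A - B)"
      unfolding ts_gen_def using transfer_system_of_types B[OF that] by (intro hull_minimal) auto
    then have le: "of_types A \<subseteq> of_types (A - B)" using S(2) by simp
    obtain \<alpha> where \<alpha>: "\<alpha> \<in> A" "\<alpha> \<in> B" using B[OF \<open>B \<in> \<B>\<close>] by blast
    have "\<alpha> \<in> type_arrows n" using A \<alpha>(1) by (auto simp: dih_closed_def)
    then obtain a where "a \<in> arrows G" "atype a = \<alpha>" using of_types_surj by blast
    then show False using le \<alpha> by (auto simp: of_types_def)
  qed
  then obtain f where f: "\<And>B. B \<in> \<B> \<Longrightarrow> f B \<in> S \<and> atype (f B) \<in> B" by metis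
  have "inj_on f \<B>"
    using f disj unfolding inj_on_def pairwise_def disjnt_def by (metis disjoint_iff)
  moreover have "f ` \<B> \<subseteq> S" using f by blast
  moreover have "finite S" using S(1) finite_arrows finite_subset by blast
  ultimately show ?thesis by (rule card_inj_on_le)
qed

end

section \<open>The extremal closed set and its removable classes\<close>

definition max_types :: "nat \<Rightarrow> nat \<Rightarrow> (stype \<times> stype) set" where
  "max_types n k = {((i, b), (j, b')). i \<le> j \<and> j \<le> n \<and> (b \<longrightarrow> b') \<and>
     (\<not> b \<and> b' \<longrightarrow> i + j \<le> 2 * k) \<and> (b \<and> b' \<longrightarrow> i = j \<or> j \<le> k)}"

lemma mem_max_types:
  "((i, b), (j, b')) \<in> max_types n k \<longleftrightarrow> i \<le> j \<and> j \<le> n \<and> (b \<longrightarrow> b') \<and>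
     (\<not> b \<and> b' \<longrightarrow> i + j \<le> 2 * k) \<and> (b \<and> b' \<longrightarrow> i = j \<or> j \<le> k)"
  by (simp add: max_types_def)

lemma max_types_subset: "max_types n k \<subseteq> type_arrows n"
  by (auto simp: max_types_def type_arrows_def)

text \<open>The bound \<open>i + j \<le> 2 * k\<close> survives restriction and composition with
  cyclic arrows, which only lower the source. Nontrivial dihedral arrows stay at levels up to
  \<open>k\<close>, so their compositions and twists obey it too.\<close>

lemma dih_closed_max_types: "dih_closed n (max_types n k)"
proof (rule dih_closedI)
  fix i b j b' l b''
  show "((i, b), (l, b'')) \<in> max_types n k"
    if "((i, b), (j, b')) \<in> max_types n k" "((j, b'), (l, b'')) \<in> max_types n k"
    using that unfolding mem_max_types by (cases b; cases b'; cases b'') auto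
  show "((min i l, b \<and> b''), (l, b'')) \<in> max_types n k"
    if "((i, b), (j, b')) \<in> max_types n k" "l \<le> j" "b'' \<longrightarrow> b'"
    using that unfolding mem_max_types by (cases b; cases b'; cases b'') auto
qed (auto simp: mem_max_types max_types_subset)

text \<open>These arrows must be removed together, as each of them restricts to the shorter
  ones.\<close>

definition from_source :: "bool \<Rightarrow> nat \<Rightarrow> (stype \<times> stype) set" where
  "from_source b m = {((m, b), (j, b)) |j. m < j}"

lemma mem_from_source:
  "((i, c), (j, c')) \<in> from_source b m \<longleftrightarrow> i = m \<and> c = b \<and> c' = b \<and> m < j"
  by (auto simp: from_source_def)

text \<open>Among arrows of one kind, a strict arrow from \<open>m\<close> arises only from strict
  arrows with source \<open>m\<close>. A cyclic one could also be a restriction of an arrow into a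
  dihedral group, but for \<open>k \<le> m\<close> no such arrow from level \<open>m\<close> rises
  above it.\<close>

lemma dih_closed_max_types_source:
  assumes "b \<or> k \<le> m"
  shows "dih_closed n (max_types n k - from_source b m)"
proof (rule dih_closedI)
  note cl = dih_closed_max_types[of n k]
  fix i c j c' l c''
  show "((i, c), (l, c'')) \<in> max_types n k - from_source b m"
    if "((i, c), (j, c')) \<in> max_types n k - from_source b m"
      "((j, c'), (l, c'')) \<in> max_types n k - from_source b m"
    using that assms dih_closed_trans[OF cl, of "(i, c)" "(j, c')" "(l, c'')"]
    by (cases b; cases c; cases c'; cases c'') (auto simp: mem_max_types mem_from_source)
  show "((min i l, c \<and> c''), (l, c'')) \<in> max_types n k - from_source b m"
    if "((i, c), (j, c')) \<in> max_types n k - from_source b m" "l \<le> j" "c'' \<longrightarrow> c'"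
    using that assms dih_closed_restrict[OF cl, of i c j c' l c'']
    by (cases b; cases c; cases c'; cases c'') (auto simp: mem_max_types mem_from_source min_def split: if_splits)
qed (auto simp: mem_max_types mem_from_source max_types_def type_arrows_def)

text \<open>The arrow attains the bound \<open>i + j \<le> 2 * k\<close>, so it is a composite only
  with a trivial factor and a restriction only of itself. Twists end below level \<open>k\<close>,
  whereas its target is at least \<open>k\<close>.\<close>

lemma dih_closed_max_types_CD:
  assumes "m \<le> k"
  shows "dih_closed n (max_types n k - {CD m (2 * k - m)})"
proof (rule dih_closedI)
  note cl = dih_closed_max_types[of n k]
  fix i c j c' l c''
  show "((i, c), (l, c'')) \<in> max_types n k - {CD m (2 * k - m)}"
    if "((i, c), (j, c')) \<in> max_types n k - {CD m (2 * k - m)}"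
      "((j, c'), (l, c'')) \<in> max_types n k - {CD m (2 * k - m)}"
    using that assms dih_closed_trans[OF cl, of "(i, c)" "(j, c')" "(l, c'')"]
    by (cases c; cases c'; cases c'') (auto simp: mem_max_types)
  show "((min i l, c \<and> c''), (l, c'')) \<in> max_types n k - {CD m (2 * k - m)}"
    if "((i, c), (j, c')) \<in> max_types n k - {CD m (2 * k - m)}" "l \<le> j" "c'' \<longrightarrow> c'"
    using that assms dih_closed_restrict[OF cl, of i c j c' l c'']
    by (cases c; cases c'; cases c'') (auto simp: mem_max_types min_def split: if_splits)
qed (use assms in \<open>auto simp: mem_max_types max_types_def type_arrows_def\<close>)

definition max_classes :: "nat \<Rightarrow> nat \<Rightarrow> (stype \<times> stype) set set" where
  "max_classes n k = from_source True ` {..<k} \<union> (\<lambda>i. {CD i (2 * k - i)}) ` {..k} \<union>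
     from_source False ` {k..<n}"

lemma pairwise_disjnt_max_classes: "pairwise disjnt (max_classes n k)"
  unfolding max_classes_def pairwise_def disjnt_def by (auto simp: from_source_def)

lemma card_max_classes:
  assumes "k \<le> n"
  shows "card (max_classes n k) = n + k + 1"
proof -
  let ?D = "from_source True" and ?X = "\<lambda>i. {CD i (2 * k - i)}" and ?C = "from_source False"
  have S: "((i, b), (Suc i, b)) \<in> from_source b i" for b i by (simp add: mem_from_source)
  have inj: "inj_on (from_source b) M" for b M
    using S mem_from_source by (metis inj_onI)
  have ne: "from_source b i \<noteq> {CD x y}" for b i x y using S[of i b] by auto
  have ne': "?D i \<noteq> ?C j" for i j
    using S[of i True] mem_from_source[of i True "Suc i" True False j] by metis
  have "card (?D ` {..<k}) = k" "card (?C ` {k..<n}) = n - k" "card (?X ` {..k}) = k + 1"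
    by (simp_all add: card_image[OF inj] card_image inj_on_def)
  moreover have "?D ` {..<k} \<inter> ?X ` {..k} = {}" "(?D ` {..<k} \<union> ?X ` {..k}) \<inter> ?C ` {k..<n} = {}"
    using ne ne' ne[symmetric] ne'[symmetric] by auto
  ultimately show ?thesis
    using assms unfolding max_classes_def by (simp add: card_Un_disjoint)
qed

lemma (in dihedral_prime_power) complexity_eq: "complexity G = n + n div 2 + 1"
proof -
  \<comment> \<open>This is the largest \<open>k\<close> with \<open>2 * k \<le> n\<close>, which
    makes all targets \<open>2 * k - i\<close> legitimate levels.\<close>
  define k where "k = n div 2"
  have k: "k \<le> n" "2 * k \<le> n" by (simp_all add: k_def)
  let ?T = "of_types (max_types n k)"
  have min: "minimal_generating_set G T (SOME S. minimal_generating_set G T S)"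
    if "transfer_system G T" for T
    using exists_minimal_generating_set[OF finite_arrows that] by (rule someI_ex)
  have le: "min_gen_size G T \<le> n + k + 1" if "T \<in> Tr G" for T
    using card_minimal_generating_set_le[OF min, of T] that by (simp add: min_gen_size_def Tr_def k_def)
  have T: "transfer_system G ?T"
    using dih_closed_max_types by (rule transfer_system_of_types)
  have "dih_closed n (max_types n k - B) \<and> max_types n k \<inter> B \<noteq> {}" if "B \<in> max_classes n k" for B
  proof -
    consider i where "i < k" "B = from_source True i" | i where "i \<le> k" "B = {CD i (2 * k - i)}"
      | i where "k \<le> i" "i < n" "B = from_source False i"
      using \<open>B \<in> max_classes n k\<close> unfolding max_classes_def by auto
    then show ?thesis
    proof cases
      case 1
      have "DD i (Suc i) \<in> max_types n k \<inter> B" using 1 k by (auto simp: mem_max_types mem_from_source)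
      then show ?thesis using dih_closed_max_types_source[of True k i n] 1 by auto
    next
      case 2
      have "CD i (2 * k - i) \<in> max_types n k \<inter> B" using 2 k by (auto simp: mem_max_types mem_from_source)
      then show ?thesis using dih_closed_max_types_CD[of i k n] 2 by auto
    next
      case 3
      have "CC i (Suc i) \<in> max_types n k \<inter> B" using 3 k by (auto simp: mem_max_types mem_from_source)
      then show ?thesis using dih_closed_max_types_source[of False k i n] 3 by auto
    qed
  qed
  moreover define S where "S = (SOME S. minimal_generating_set G ?T S)"
  then have "S \<subseteq> arrows G" "ts_gen G S = ?T"
    using min[OF T] by (auto simp: minimal_generating_set_def)
  ultimately have "n + k + 1 \<le> card S"
    using card_generating_set_ge[OF dih_closed_max_types _ _ pairwise_disjnt_max_classes, of S k n k]
      card_max_classes[OF k(1)] by simp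
  then have "min_gen_size G ?T = n + k + 1"
    using le[of ?T] T by (simp add: min_gen_size_def S_def Tr_def)
  moreover have "{min_gen_size G T |T. T \<in> Tr G} \<subseteq> {..n + k + 1}" using le by auto
  then have "finite {min_gen_size G T |T. T \<in> Tr G}" by (rule finite_subset) simp
  ultimately have "Max {min_gen_size G T |T. T \<in> Tr G} = n + k + 1"
    using le T by (intro Max_eqI) (auto simp: Tr_def intro: exI[of _ ?T])
  then show ?thesis by (simp add: complexity_def k_def)
qed

theorem theoremD:
  fixes G :: "('a, 'b) monoid_scheme" and r s :: 'a and p n :: nat
  assumes "Factorial_Ring.prime p" and "odd p" and "n \<ge> 1"
    and "dihedral G (p ^ n) r s"
  shows "int (complexity G) = \<lfloor>3 * real n / 2\<rfloor> + 1 \<and>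
    (\<forall>k. (n = 2 * k \<longrightarrow> complexity G = 3 * k + 1) \<and>
         (n = 2 * k + 1 \<longrightarrow> complexity G = 3 * k + 2))"
proof -
  interpret dihedral_prime_power G r s p n
    using assms by unfold_locales
  have "\<lfloor>3 * real n / 2\<rfloor> = int (3 * n div 2)"
    using floor_divide_of_nat_eq[of "3 * n" 2, where 'a = real] by simp
  also have "3 * n div 2 = n + n div 2" by presburger
  finally show ?thesis by (auto simp: complexity_eq)
qed

end
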